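(* Let $(\mathcal{A},\tau,M,\mathfrak{a}_{\mathcal{A}})$ be an anchored bundle, and let $\mathfrak{D}=\{D_i\}_{i\in I}$ be a finite set of differential operators on $\mathcal{A}$, with symbols $\{\hat{D}_i\}_{i\in I}$, satisfying $$[D_i,D_j]:=D_iD_j-D_jD_i=f_{ij}^kD_k$$ with $f_{ij}^k\in C^\infty(M)$. Let $\xi=\{\xi^i\}_{i\in I}$ be a family of sections of the dual bundle $\mathcal{A}^*$ such that the dual operators satisfy $$D_i^*(\xi^j)=g_{ik}^j\xi^k$$ with $g_{ik}^j\in C^\infty(M)$. Define $$\mathfrak{a}_{\mathcal{A}}^{(\mathfrak{D},\xi)}:\Gamma(\mathcal{A})\to\Gamma(TM),\quad\mathfrak{a}_{\mathcal{A}}^{(\mathfrak{D},\xi)}(X):=\langle X,\xi^i\rangle\hat{D}_i,$$ $$\nabla^{(\mathfrak{D},\xi)}:\Gamma(\mathcal{A})\otimes\Gamma(\mathcal{A})\to\Gamma(\mathcal{A}),\quad\nabla^{(\mathfrak{D},\xi)}_X(Y):=\langle X,\xi^i\rangle D_i(Y),$$ $$[X,Y]^{\nabla^{(\mathfrak{D},\xi)}}:=\nabla^{(\mathfrak{D},\xi)}_X(Y)-\nabla^{(\mathfrak{D},\xi)}_Y(X).$$ If $$f_{ij}^k=g_{ji}^k-g_{ij}^k\quad\text{for all }i,j,k\in I,$$ then $(\mathcal{A},\tau,M,\mathfrak{a}_{\mathcal{A}}^{(\mathfrak{D},\xi)},[\bullet,\bullet]^{\nabla^{(\mathfrak{D},\xi)}})$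 is a Lie algebroid.
   Context: Repeated indices are summed over $I$. An anchored bundle $(\mathcal{A},\tau,M,\mathfrak{a}_{\mathcal{A}})$ is a smooth vector bundle $\tau:\mathcal{A}\to M$ with a vector bundle morphism $\mathfrak{a}_{\mathcal{A}}:\mathcal{A}\to TM$ (the anchor). It is a Lie algebroid if $\Gamma(\mathcal{A})$ carries a Lie bracket $[\bullet,\bullet]$ with $\mathfrak{a}_{\mathcal{A}}([X,Y])=[\mathfrak{a}_{\mathcal{A}}(X),\mathfrak{a}_{\mathcal{A}}(Y)]$ and $[X,fY]=f[X,Y]+\mathfrak{a}_{\mathcal{A}}(X)(f)Y$ for all $X,Y\in\Gamma(\mathcal{A})$, $f\in C^\infty(M)$. A differential operator on $\mathcal{A}$ is an $\mathbb{R}$-linear map $D:\Gamma(\mathcal{A})\to\Gamma(\mathcal{A})$ together with a vector field $\hat{D}\in\Gamma(TM)$ (its symbol) such that $D(fY)=fD(Y)+\hat{D}(f)Y$ for all $Y\in\Gamma(\mathcal{A})$, $f\in C^\infty(M)$. Its dual operator $D^*:\Gamma(\mathcal{A}^* )\to\Gamma(\mathcal{A}^* )$ is defined by $\langle X,D^*(\zeta)\rangle:=\hat{D}(\langle X,\zeta\rangle)-\langle D(X),\zeta\rangle$ for $X\in\Gamma(\mathcal{A})$, $\zeta\in\Gamma(\mathcal{A}^* )$. *)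

theory Defs
  imports "HOL-Analysis.Analysis" "HOL-Library.Function_Algebras"
begin

section \<open>Functions into a real vector space form a real vector space\<close>

instantiation "fun" :: (type, real_vector) real_vector
begin

definition "scaleR c f = (\<lambda>x. c *\<^sub>R f x)"

instance
  by standard (simp_all add: scaleR_fun_def fun_eq_iff scaleR_add_right scaleR_add_left)

end

lemma scaleR_fun_apply [simp]: "(c *\<^sub>R f) x = c *\<^sub>R f x"
  by (simp add: scaleR_fun_def)

lemma sum_fun_apply: "(\<Sum>i\<in>I. f i) x = (\<Sum>i\<in>I. f i x)"
  by (induction I rule: infinite_finite_induct) simp_all

definition linear_on_subspace :: "'v::real_vector set \<Rightarrow> ('v \<Rightarrow> 'w::real_vector) \<Rightarrow> bool" where
  "linear_on_subspace S h \<longleftrightarrow>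
     (\<forall>x\<in>S. \<forall>y\<in>S. h (x + y) = h x + h y) \<and> (\<forall>c. \<forall>x\<in>S. h (c *\<^sub>R x) = c *\<^sub>R h x)"

section \<open>Smooth functions on open subsets of Euclidean space\<close>

text \<open>\<open>\<real>\<^sup>n\<close> is the library's \<^const>\<open>Euclidean_space\<close> \<open>n\<close>, whose points are the
  \<open>x :: nat \<Rightarrow> real\<close> with \<open>x i = 0\<close> for \<open>i \<ge> n\<close>; this allows an arbitrary dimension, \<open>0\<close> included.\<close>

definition partial_deriv :: "nat \<Rightarrow> ((nat \<Rightarrow> real) \<Rightarrow> real) \<Rightarrow> (nat \<Rightarrow> real) \<Rightarrow> real" where
  "partial_deriv i f x = deriv (\<lambda>t. f (x(i := t))) (x i)"

fun Ck_on :: "nat \<Rightarrow> nat \<Rightarrow> (nat \<Rightarrow> real) set \<Rightarrow> ((nat \<Rightarrow> real) \<Rightarrow> real) \<Rightarrow> bool" where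
  "Ck_on n 0 S f \<longleftrightarrow> continuous_map (subtopology (Euclidean_space n) S) euclideanreal f"
| "Ck_on n (Suc k) S f \<longleftrightarrow>
     continuous_map (subtopology (Euclidean_space n) S) euclideanreal f \<and>
     (\<forall>i<n. (\<forall>x\<in>S. (\<lambda>t. f (x(i := t))) field_differentiable (at (x i))) \<and>
            Ck_on n k S (partial_deriv i f))"

text \<open>Used only for \<open>S\<close> open in \<open>\<real>\<^sup>n\<close>.\<close>

definition Cinf_on :: "nat \<Rightarrow> (nat \<Rightarrow> real) set \<Rightarrow> ((nat \<Rightarrow> real) \<Rightarrow> real) \<Rightarrow> bool" where
  "Cinf_on n S f \<longleftrightarrow> (\<forall>k. Ck_on n k S f)"

section \<open>Smooth manifolds\<close>

text \<open>The underlying set of the manifold is the whole type \<open>'m\<close> with its (Hausdorff, second countable)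
  topology. The atlas need not be maximal.\<close>

record 'm mfd =
  mdim :: nat
  atlas :: "('m set \<times> ('m \<Rightarrow> nat \<Rightarrow> real)) set"

definition smooth_manifold :: "'m::{t2_space,second_countable_topology} mfd \<Rightarrow> bool" where
  "smooth_manifold M \<longleftrightarrow>
     (\<forall>(U, \<phi>)\<in>atlas M.
        open U \<and> openin (Euclidean_space (mdim M)) (\<phi> ` U) \<and>
        homeomorphic_map (top_of_set U) (subtopology (Euclidean_space (mdim M)) (\<phi> ` U)) \<phi>) \<and>
     (\<Union>(U, \<phi>)\<in>atlas M. U) = UNIV \<and>
     (\<forall>(U, \<phi>)\<in>atlas M. \<forall>(V, \<psi>)\<in>atlas M. \<forall>i<mdim M.
        Cinf_on (mdim M) (\<phi> ` (U \<inter> V)) (\<lambda>x. \<psi> (inv_into U \<phi> x) i))"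

text \<open>Smoothness of a real function on an open subset \<open>W\<close> of \<open>M\<close>; values outside \<open>W\<close> are irrelevant.\<close>

definition smooth_fun_on :: "'m::topological_space mfd \<Rightarrow> 'm set \<Rightarrow> ('m \<Rightarrow> real) \<Rightarrow> bool" where
  "smooth_fun_on M W f \<longleftrightarrow>
     (\<forall>(U, \<phi>)\<in>atlas M. Cinf_on (mdim M) (\<phi> ` (U \<inter> W)) (\<lambda>x. f (inv_into U \<phi> x)))"

definition Cinf :: "'m::topological_space mfd \<Rightarrow> ('m \<Rightarrow> real) set" where
  "Cinf M = {f. smooth_fun_on M UNIV f}"

definition smooth_near :: "'m::topological_space mfd \<Rightarrow> 'm \<Rightarrow> ('m \<Rightarrow> real) \<Rightarrow> bool" where
  "smooth_near M p f \<longleftrightarrow> (\<exists>W. open W \<and> p \<in> W \<and> smooth_fun_on M W f)"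

section \<open>Smooth vector bundles\<close>

text \<open>A bundle is given by its fibres, realised as subspaces of one real vector space \<open>'v\<close>. Its total
  space is the disjoint union \<open>SIGMA p:UNIV. fibre E p\<close>, with the first component as projection; its
  smooth structure is the one determined by the local trivialisations. A local trivialisation over
  \<open>U\<close> is given by linear isomorphisms \<open>\<Phi> p\<close> from the fibre at \<open>p \<in> U\<close> to \<open>\<real>\<^sup>r\<close>.\<close>

record ('m, 'v) vbundle =
  fibre :: "'m \<Rightarrow> 'v set"
  rank :: nat
  trivs :: "('m set \<times> ('m \<Rightarrow> 'v \<Rightarrow> nat \<Rightarrow> real)) set"

definition unit_vec :: "nat \<Rightarrow> nat \<Rightarrow> real" where
  "unit_vec j = (\<lambda>i. if i = j then 1 else 0)"

definition local_frame :: "('m, 'v) vbundle \<Rightarrow> ('m \<Rightarrow> 'v \<Rightarrow> nat \<Rightarrow> real) \<Rightarrow> nat \<Rightarrow> 'm \<Rightarrow> 'v" where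
  "local_frame E \<Phi> j p = inv_into (fibre E p) (\<Phi> p) (unit_vec j)"

definition vector_bundle ::
    "'m::topological_space mfd \<Rightarrow> ('m, 'v::real_vector) vbundle \<Rightarrow> bool" where
  "vector_bundle M E \<longleftrightarrow>
     (\<forall>p. subspace (fibre E p)) \<and>
     (\<Union>(U, \<Phi>)\<in>trivs E. U) = UNIV \<and>
     (\<forall>(U, \<Phi>)\<in>trivs E. open U \<and>
        (\<forall>p\<in>U. linear_on_subspace (fibre E p) (\<Phi> p) \<and>
                bij_betw (\<Phi> p) (fibre E p) (topspace (Euclidean_space (rank E))))) \<and>
     (\<forall>(U, \<Phi>)\<in>trivs E. \<forall>(V, \<Psi>)\<in>trivs E. \<forall>i<rank E. \<forall>j<rank E.
        smooth_fun_on M (U \<inter> V) (\<lambda>p. \<Psi> p (local_frame E \<Phi> j p) i))"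

definition sections ::
    "'m::topological_space mfd \<Rightarrow> ('m, 'v) vbundle \<Rightarrow> ('m \<Rightarrow> 'v) set" where
  "sections M E =
     {s. (\<forall>p. s p \<in> fibre E p) \<and>
         (\<forall>(U, \<Phi>)\<in>trivs E. \<forall>i<rank E. smooth_fun_on M U (\<lambda>p. \<Phi> p (s p) i))}"

text \<open>Vector bundle morphisms over the identity of \<open>M\<close>: fibrewise linear maps depending smoothly on the
  base point, i.e. with smooth matrices in local trivialisations.\<close>

definition vb_morphism ::
    "'m::topological_space mfd \<Rightarrow> ('m, 'v::real_vector) vbundle \<Rightarrow> ('m, 'w::real_vector) vbundle
      \<Rightarrow> ('m \<Rightarrow> 'v \<Rightarrow> 'w) \<Rightarrow> bool" where
  "vb_morphism M E F h \<longleftrightarrow>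
     (\<forall>p. h p ` fibre E p \<subseteq> fibre F p \<and> linear_on_subspace (fibre E p) (h p)) \<and>
     (\<forall>(U, \<Phi>)\<in>trivs E. \<forall>(V, \<Psi>)\<in>trivs F. \<forall>j<rank E. \<forall>i<rank F.
        smooth_fun_on M (U \<inter> V) (\<lambda>p. \<Psi> p (h p (local_frame E \<Phi> j p)) i))"

definition on_sections :: "('m \<Rightarrow> 'v \<Rightarrow> 'w) \<Rightarrow> ('m \<Rightarrow> 'v) \<Rightarrow> 'm \<Rightarrow> 'w" where
  "on_sections h X = (\<lambda>p. h p (X p))"

definition fun_smult :: "('m \<Rightarrow> real) \<Rightarrow> ('m \<Rightarrow> 'v::real_vector) \<Rightarrow> 'm \<Rightarrow> 'v"  (infixr "\<odot>" 75) where
  "f \<odot> X = (\<lambda>p. f p *\<^sub>R X p)"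

text \<open>The dual bundle, trivialised by the dual frames. A functional on \<open>fibre E p\<close> is represented by the
  function on \<open>'v\<close> extending it by \<open>0\<close> off the fibre.\<close>

definition dual_bundle :: "('m, 'v::real_vector) vbundle \<Rightarrow> ('m, 'v \<Rightarrow> real) vbundle" where
  "dual_bundle E =
     \<lparr> fibre = (\<lambda>p. {\<zeta>. linear_on_subspace (fibre E p) \<zeta> \<and> (\<forall>x. x \<notin> fibre E p \<longrightarrow> \<zeta> x = 0)}),
       rank = rank E,
       trivs = (\<lambda>(U, \<Phi>). (U, \<lambda>p \<zeta> i. if i < rank E then \<zeta> (local_frame E \<Phi> i p) else 0)) ` trivs E \<rparr>"

definition pairing :: "('m \<Rightarrow> 'v) \<Rightarrow> ('m \<Rightarrow> 'v \<Rightarrow> real) \<Rightarrow> 'm \<Rightarrow> real"  ("\<langle>_, _\<rangle>") where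
  "\<langle>X, \<zeta>\<rangle> = (\<lambda>p. \<zeta> p (X p))"

section \<open>Tangent bundle and vector fields\<close>

text \<open>Tangent vectors at \<open>p\<close> are the derivations on functions smooth near \<open>p\<close>; they are set to \<open>0\<close> on all
  other functions. The Leibniz rule with the indicator function of a small neighbourhood of \<open>p\<close>
  shows that such a derivation depends only on germs at \<open>p\<close>.\<close>

definition tangent_space :: "'m::topological_space mfd \<Rightarrow> 'm \<Rightarrow> (('m \<Rightarrow> real) \<Rightarrow> real) set" where
  "tangent_space M p =
     {v. (\<forall>f g. smooth_near M p f \<longrightarrow> smooth_near M p g \<longrightarrow>
                v (f + g) = v f + v g \<and> v (f * g) = f p * v g + g p * v f) \<and>
         (\<forall>c f. smooth_near M p f \<longrightarrow> v (c *\<^sub>R f) = c * v f) \<and>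
         (\<forall>f. \<not> smooth_near M p f \<longrightarrow> v f = 0)}"

text \<open>In the trivialisation given by a chart \<open>\<phi>\<close>, the components of \<open>v\<close> are \<open>v (\<phi>\<^sup>i)\<close>.\<close>

definition tangent_bundle :: "'m::topological_space mfd \<Rightarrow> ('m, ('m \<Rightarrow> real) \<Rightarrow> real) vbundle" where
  "tangent_bundle M =
     \<lparr> fibre = tangent_space M,
       rank = mdim M,
       trivs = (\<lambda>(U, \<phi>). (U, \<lambda>p v i. if i < mdim M then v (\<lambda>q. \<phi> q i) else 0)) ` atlas M \<rparr>"

definition vf_apply :: "('m \<Rightarrow> ('m \<Rightarrow> real) \<Rightarrow> real) \<Rightarrow> ('m \<Rightarrow> real) \<Rightarrow> 'm \<Rightarrow> real" where
  "vf_apply V f = (\<lambda>p. V p f)"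

definition vf_bracket ::
    "'m::topological_space mfd \<Rightarrow> ('m \<Rightarrow> ('m \<Rightarrow> real) \<Rightarrow> real) \<Rightarrow> ('m \<Rightarrow> ('m \<Rightarrow> real) \<Rightarrow> real)
      \<Rightarrow> 'm \<Rightarrow> ('m \<Rightarrow> real) \<Rightarrow> real" where
  "vf_bracket M V W = (\<lambda>p f.
     if smooth_near M p f then V p (vf_apply W f) - W p (vf_apply V f) else 0)"

section \<open>Anchored bundles, Lie algebroids, differential operators\<close>

definition anchored_bundle ::
    "'m::{t2_space,second_countable_topology} mfd \<Rightarrow> ('m, 'v::real_vector) vbundle
      \<Rightarrow> ('m \<Rightarrow> 'v \<Rightarrow> ('m \<Rightarrow> real) \<Rightarrow> real) \<Rightarrow> bool" where
  "anchored_bundle M A \<rho> \<longleftrightarrow>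
     smooth_manifold M \<and> vector_bundle M A \<and> vb_morphism M A (tangent_bundle M) \<rho>"

definition lie_bracket_on :: "'s::real_vector set \<Rightarrow> ('s \<Rightarrow> 's \<Rightarrow> 's) \<Rightarrow> bool" where
  "lie_bracket_on S br \<longleftrightarrow>
     (\<forall>X\<in>S. \<forall>Y\<in>S. br X Y \<in> S) \<and>
     (\<forall>X\<in>S. linear_on_subspace S (br X) \<and> linear_on_subspace S (\<lambda>Y. br Y X)) \<and>
     (\<forall>X\<in>S. br X X = 0) \<and>
     (\<forall>X\<in>S. \<forall>Y\<in>S. \<forall>Z\<in>S. br X (br Y Z) + br Y (br Z X) + br Z (br X Y) = 0)"

definition lie_algebroid ::
    "'m::{t2_space,second_countable_topology} mfd \<Rightarrow> ('m, 'v::real_vector) vbundle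
      \<Rightarrow> ('m \<Rightarrow> 'v \<Rightarrow> ('m \<Rightarrow> real) \<Rightarrow> real) \<Rightarrow> (('m \<Rightarrow> 'v) \<Rightarrow> ('m \<Rightarrow> 'v) \<Rightarrow> 'm \<Rightarrow> 'v) \<Rightarrow> bool" where
  "lie_algebroid M A \<rho> br \<longleftrightarrow>
     anchored_bundle M A \<rho> \<and>
     lie_bracket_on (sections M A) br \<and>
     (\<forall>X\<in>sections M A. \<forall>Y\<in>sections M A.
        on_sections \<rho> (br X Y) = vf_bracket M (on_sections \<rho> X) (on_sections \<rho> Y)) \<and>
     (\<forall>X\<in>sections M A. \<forall>Y\<in>sections M A. \<forall>f\<in>Cinf M.
        br X (f \<odot> Y) = f \<odot> br X Y + vf_apply (on_sections \<rho> X) f \<odot> Y)"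

text \<open>\<open>differential_operator M A D D'\<close>: \<open>D\<close> is a differential operator on \<open>A\<close> with symbol \<open>D'\<close>.
  Only the values of \<open>D\<close> on smooth sections matter.\<close>

definition differential_operator ::
    "'m::topological_space mfd \<Rightarrow> ('m, 'v::real_vector) vbundle
      \<Rightarrow> (('m \<Rightarrow> 'v) \<Rightarrow> 'm \<Rightarrow> 'v) \<Rightarrow> ('m \<Rightarrow> ('m \<Rightarrow> real) \<Rightarrow> real) \<Rightarrow> bool" where
  "differential_operator M A D D' \<longleftrightarrow>
     D ` sections M A \<subseteq> sections M A \<and>
     linear_on_subspace (sections M A) D \<and>
     D' \<in> sections M (tangent_bundle M) \<and>
     (\<forall>Y\<in>sections M A. \<forall>f\<in>Cinf M. D (f \<odot> Y) = f \<odot> D Y + vf_apply D' f \<odot> Y)"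

definition dual_operator ::
    "'m::topological_space mfd \<Rightarrow> ('m, 'v::real_vector) vbundle
      \<Rightarrow> (('m \<Rightarrow> 'v) \<Rightarrow> 'm \<Rightarrow> 'v) \<Rightarrow> ('m \<Rightarrow> ('m \<Rightarrow> real) \<Rightarrow> real)
      \<Rightarrow> ('m \<Rightarrow> 'v \<Rightarrow> real) \<Rightarrow> 'm \<Rightarrow> 'v \<Rightarrow> real" where
  "dual_operator M A D D' \<zeta> =
     (THE \<eta>. \<eta> \<in> sections M (dual_bundle A) \<and>
        (\<forall>X\<in>sections M A. \<langle>X, \<eta>\<rangle> = vf_apply D' \<langle>X, \<zeta>\<rangle> - \<langle>D X, \<zeta>\<rangle>))"

section \<open>The structure defined by differential operators and dual sections\<close>

text \<open>Here \<open>D i\<close>, \<open>D' i\<close> and \<open>\<xi> i\<close> are the operators, their symbols and the sections of the dual bundle.\<close>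

definition dxi_anchor ::
    "'i set \<Rightarrow> ('i \<Rightarrow> 'm \<Rightarrow> ('m \<Rightarrow> real) \<Rightarrow> real) \<Rightarrow> ('i \<Rightarrow> 'm \<Rightarrow> 'v \<Rightarrow> real)
      \<Rightarrow> 'm \<Rightarrow> 'v \<Rightarrow> ('m \<Rightarrow> real) \<Rightarrow> real" where
  "dxi_anchor I D' \<xi> p x = (\<Sum>i\<in>I. \<xi> i p x *\<^sub>R D' i p)"

text \<open>The map that this bundle map induces on sections:\<close>

lemma on_sections_dxi_anchor:
  "on_sections (dxi_anchor I D' \<xi>) X = (\<Sum>i\<in>I. \<langle>X, \<xi> i\<rangle> \<odot> D' i)"
  by (simp add: fun_eq_iff on_sections_def dxi_anchor_def pairing_def fun_smult_def sum_fun_apply)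

definition dxi_nabla ::
    "'i set \<Rightarrow> ('i \<Rightarrow> ('m \<Rightarrow> 'v) \<Rightarrow> 'm \<Rightarrow> 'v) \<Rightarrow> ('i \<Rightarrow> 'm \<Rightarrow> 'v \<Rightarrow> real)
      \<Rightarrow> ('m \<Rightarrow> 'v::real_vector) \<Rightarrow> ('m \<Rightarrow> 'v) \<Rightarrow> 'm \<Rightarrow> 'v" where
  "dxi_nabla I D \<xi> X Y = (\<Sum>i\<in>I. \<langle>X, \<xi> i\<rangle> \<odot> D i Y)"

definition dxi_bracket ::
    "'i set \<Rightarrow> ('i \<Rightarrow> ('m \<Rightarrow> 'v) \<Rightarrow> 'm \<Rightarrow> 'v) \<Rightarrow> ('i \<Rightarrow> 'm \<Rightarrow> 'v \<Rightarrow> real)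
      \<Rightarrow> ('m \<Rightarrow> 'v::real_vector) \<Rightarrow> ('m \<Rightarrow> 'v) \<Rightarrow> 'm \<Rightarrow> 'v" where
  "dxi_bracket I D \<xi> X Y = dxi_nabla I D \<xi> X Y - dxi_nabla I D \<xi> Y X"

end

theory Submission
  imports Defs
begin

text \<open>
  Write \<open>X\<^sup>i\<close> for \<open>\<langle>X, \<xi> i\<rangle>\<close>, and let \<open>\<nabla>\<close> be \<^const>\<open>dxi_nabla\<close>. It satisfies the Leibniz rule of a
  connection along the new anchor, and the bracket is by definition the one without torsion, so
  everything rests on one formula for the components of the bracket,
  \<open>[X, Y]\<^sup>k = X\<^sup>i D'\<^sub>i(Y\<^sup>k) - Y\<^sup>i D'\<^sub>i(X\<^sup>k) + f\<^sub>i\<^sub>j\<^sup>k X\<^sup>i Y\<^sup>j\<close>.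
  Its first two terms come from differentiating a pairing; the last one collects the coefficients of the
  dual operators, as \<open>g\<^sub>j\<^sub>i\<^sup>k - g\<^sub>i\<^sub>j\<^sup>k\<close>, and is where the compatibility condition is used
  (\<open>bracket_component\<close>). On the other hand the commutator of two first order expressions \<open>X\<^sup>i D\<^sub>i\<close> and
  \<open>Y\<^sup>j D\<^sub>j\<close> has exactly these coefficients as soon as \<open>D\<^sub>i D\<^sub>j - D\<^sub>j D\<^sub>i = f\<^sub>i\<^sub>j\<^sup>k D\<^sub>k\<close>
  (\<open>double_commutator_sum\<close>). For the operators this says that \<open>\<nabla>\<close> is flat (\<open>nabla_flat\<close>), and
  flatness with vanishing torsion gives the Jacobi identity. For the symbols it says that the anchor preserves
  brackets (\<open>anchor_bracket\<close>); the commutators of the symbols are read off from those of the operators by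
  applying the latter to \<open>F \<odot> Y\<close> with \<open>Y\<close> a section that does not vanish at the given point
  (\<open>symbol_commutator\<close>).

  The analysis lies in the dual operator. It is a definite description, so that its defining equation is
  available only once there is exactly one section of the dual bundle with the prescribed pairings. Uniqueness
  needs a global section through every vector; existence needs the locality of \<open>C\<^sup>\<infinity>\<close>-linear maps on sections
  and the smoothness of their components. Both follow from smooth cutoff functions
  (\<open>ex_cutoff\<close>), for which functions of class \<open>C\<^sup>k\<close> in the sense of \<^const>\<open>Ck_on\<close> are shown to
  be closed under sums, products, gluing and composition with a smooth plateau. Cutoffs also extend germs of
  functions to global functions, which is how the bracket of vector fields, defined on germs, is
  reached from operators on global sections.
\<close>

section \<open>Calculus on open subsets of Euclidean space\<close>

lemma Euclidean_space_eq_top_of_set: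
  "Euclidean_space n = top_of_set (topspace (Euclidean_space n))"
  by (simp add: Euclidean_space_def euclidean_product_topology)

lemma subtopology_Euclidean_space_eq:
  assumes "S \<subseteq> topspace (Euclidean_space n)"
  shows "subtopology (Euclidean_space n) S = top_of_set S"
  using assms by (subst Euclidean_space_eq_top_of_set) (simp add: subtopology_subtopology Int_absorb1)

lemma continuous_map_Euclidean_subspace_iff:
  assumes "openin (Euclidean_space n) S"
  shows "continuous_map (subtopology (Euclidean_space n) S) euclideanreal f \<longleftrightarrow> continuous_on S f"
  using subtopology_Euclidean_space_eq[OF openin_subset[OF assms]] by simp

text \<open>Because of this, partial derivatives at points of an open set depend only on the values on that set.\<close>

lemma eventually_coordinate_change_in_open:
  assumes S: "openin (Euclidean_space n) S" and x: "x \<in> S" and i: "i < n"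
  shows "\<forall>\<^sub>F t in nhds (x i). x(i := t) \<in> S"
proof -
  obtain T where T: "open T" "S = topspace (Euclidean_space n) \<inter> T"
    using S by (subst (asm) Euclidean_space_eq_top_of_set) (auto simp: openin_open)
  have "continuous_on UNIV (\<lambda>t. x(i := t))"
    by (rule continuous_on_coordinatewise_then_product) (rename_tac j, case_tac "j = i"; simp)
  then have "open ((\<lambda>t. x(i := t)) -` T)"
    using T by (simp add: open_vimage)
  moreover have "x i \<in> (\<lambda>t. x(i := t)) -` T"
    using x T by simp
  ultimately have "\<forall>\<^sub>F t in nhds (x i). x(i := t) \<in> T"
    by (auto simp: eventually_nhds)
  then show ?thesis
    using x i T by (auto simp: topspace_Euclidean_space elim!: eventually_mono)
qed

lemma has_partial_derivative_cong:
  assumes S: "openin (Euclidean_space n) S" and x: "x \<in> S" and i: "i < n"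
    and eq: "\<And>y. y \<in> S \<Longrightarrow> f y = g y"
  shows "((\<lambda>t. f (x(i := t))) has_real_derivative d) (at (x i)) \<longleftrightarrow>
         ((\<lambda>t. g (x(i := t))) has_real_derivative d) (at (x i))"
proof (rule DERIV_cong_ev)
  show "\<forall>\<^sub>F t in nhds (x i). f (x(i := t)) = g (x(i := t))"
    using eventually_coordinate_change_in_open[OF S x i] by eventually_elim (rule eq)
qed auto

lemma partial_deriv_eq:
  "((\<lambda>t. f (x(i := t))) has_real_derivative d) (at (x i)) \<Longrightarrow> partial_deriv i f x = d"
  by (simp add: partial_deriv_def DERIV_imp_deriv)

lemma Ck_on_continuous_on:
  assumes "openin (Euclidean_space n) S" "Ck_on n k S f"
  shows "continuous_on S f"
  using assms by (cases k) (auto simp: continuous_map_Euclidean_subspace_iff)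

lemma Ck_on_Suc_has_partial_deriv:
  assumes "Ck_on n (Suc k) S f" "x \<in> S" "i < n"
  shows "((\<lambda>t. f (x(i := t))) has_real_derivative partial_deriv i f x) (at (x i))"
  using assms by (auto simp: partial_deriv_def DERIV_deriv_iff_field_differentiable)

lemma Ck_on_cong:
  assumes S: "openin (Euclidean_space n) S" and "Ck_on n k S f" "\<And>y. y \<in> S \<Longrightarrow> f y = g y"
  shows "Ck_on n k S g"
  using assms(2,3)
proof (induction k arbitrary: f g)
  case 0
  then show ?case
    using S by (auto simp: continuous_map_Euclidean_subspace_iff cong: continuous_on_cong)
next
  case (Suc k)
  have eq: "f y = g y" if "y \<in> S" for y
    using Suc.prems that by auto
  have der: "((\<lambda>t. g (x(i := t))) has_real_derivative partial_deriv i f x) (at (x i))"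
    if "x \<in> S" "i < n" for x i
    using Ck_on_Suc_has_partial_deriv[OF Suc.prems(1) that]
      has_partial_derivative_cong[OF S that, of f g] eq by blast
  have "continuous_on S g"
    using Ck_on_continuous_on[OF S Suc.prems(1)] eq by (simp cong: continuous_on_cong)
  moreover have "Ck_on n k S (partial_deriv i g)" if "i < n" for i
  proof (rule Suc.IH)
    show "Ck_on n k S (partial_deriv i f)"
      using Suc.prems(1) that by simp
    show "partial_deriv i f y = partial_deriv i g y" if "y \<in> S" for y
      using partial_deriv_eq[OF der[OF that \<open>i < n\<close>]] by (rule sym)
  qed
  ultimately show ?case
    using der S by (auto simp: continuous_map_Euclidean_subspace_iff field_differentiable_def)
qed

text \<open>An introduction rule in which the partial derivatives are given by explicit functions \<open>G\<close>, to be right on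
  \<open>S\<close> only.\<close>

lemma Ck_on_SucI:
  assumes S: "openin (Euclidean_space n) S" and cont: "continuous_on S f"
    and der: "\<And>x i. x \<in> S \<Longrightarrow> i < n \<Longrightarrow>
      ((\<lambda>t. f (x(i := t))) has_real_derivative G i x) (at (x i))"
    and G: "\<And>i. i < n \<Longrightarrow> Ck_on n k S (G i)"
  shows "Ck_on n (Suc k) S f"
proof -
  have "Ck_on n k S (partial_deriv i f)" if "i < n" for i
    using G[OF that] by (rule Ck_on_cong[OF S]) (rule partial_deriv_eq[OF der[OF _ that], symmetric])
  then show ?thesis
    using S cont der by (auto simp: continuous_map_Euclidean_subspace_iff field_differentiable_def)
qed

lemma Ck_on_SucD:
  assumes S: "openin (Euclidean_space n) S" and "Ck_on n (Suc k) S f"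
  shows "Ck_on n k S f"
  using assms(2)
proof (induction k arbitrary: f)
  case (Suc k)
  then show ?case by auto
qed auto

lemma Ck_on_const:
  assumes S: "openin (Euclidean_space n) S"
  shows "Ck_on n k S (\<lambda>x. c)"
proof (induction k arbitrary: c)
  case (Suc k)
  show ?case
    by (rule Ck_on_SucI[OF S, where G = "\<lambda>i x. 0"]) (auto intro: Suc)
qed auto

lemma Ck_on_add:
  assumes S: "openin (Euclidean_space n) S" and "Ck_on n k S f" "Ck_on n k S g"
  shows "Ck_on n k S (\<lambda>x. f x + g x)"
  using assms(2,3)
proof (induction k arbitrary: f g)
  case 0
  then show ?case
    using S by (auto simp: continuous_map_Euclidean_subspace_iff intro: continuous_intros)
next
  case (Suc k)
  show ?case
  proof (rule Ck_on_SucI[OF S, where G = "\<lambda>i x. partial_deriv i f x + partial_deriv i g x"])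
    show "continuous_on S (\<lambda>x. f x + g x)"
      using Ck_on_continuous_on[OF S Suc.prems(1)] Ck_on_continuous_on[OF S Suc.prems(2)]
      by (rule continuous_on_add)
    show "((\<lambda>t. f (x(i := t)) + g (x(i := t))) has_real_derivative
        partial_deriv i f x + partial_deriv i g x) (at (x i))" if "x \<in> S" "i < n" for x i
      by (rule DERIV_add[OF Ck_on_Suc_has_partial_deriv[OF Suc.prems(1) that]
            Ck_on_Suc_has_partial_deriv[OF Suc.prems(2) that]])
    show "Ck_on n k S (\<lambda>x. partial_deriv i f x + partial_deriv i g x)" if "i < n" for i
      using Suc.prems that by (intro Suc.IH) auto
  qed
qed

lemma Ck_on_mult:
  assumes S: "openin (Euclidean_space n) S" and "Ck_on n k S f" "Ck_on n k S g"
  shows "Ck_on n k S (\<lambda>x. f x * g x)"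
  using assms(2,3)
proof (induction k arbitrary: f g)
  case 0
  then show ?case
    using S by (auto simp: continuous_map_Euclidean_subspace_iff intro: continuous_intros)
next
  case (Suc k)
  show ?case
  proof (rule Ck_on_SucI[OF S, where G = "\<lambda>i x. partial_deriv i f x * g x + partial_deriv i g x * f x"])
    show "continuous_on S (\<lambda>x. f x * g x)"
      using Ck_on_continuous_on[OF S Suc.prems(1)] Ck_on_continuous_on[OF S Suc.prems(2)]
      by (rule continuous_on_mult)
    show "((\<lambda>t. f (x(i := t)) * g (x(i := t))) has_real_derivative
        partial_deriv i f x * g x + partial_deriv i g x * f x) (at (x i))"
      if "x \<in> S" "i < n" for x i
      using DERIV_mult[OF Ck_on_Suc_has_partial_deriv[OF Suc.prems(1) that]
          Ck_on_Suc_has_partial_deriv[OF Suc.prems(2) that]] by (simp only: fun_upd_triv)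
    show "Ck_on n k S (\<lambda>x. partial_deriv i f x * g x + partial_deriv i g x * f x)" if "i < n" for i
      using Suc.prems that Ck_on_SucD[OF S Suc.prems(1)] Ck_on_SucD[OF S Suc.prems(2)]
      by (intro Ck_on_add Suc.IH S) auto
  qed
qed

text \<open>Since the derivative of each member of the family \<open>H\<close> is a combination of members, the induction on
  \<open>k\<close> can run for all of them at once.\<close>

lemma Ck_on_compose:
  fixes H :: "nat \<Rightarrow> real \<Rightarrow> real"
  assumes S: "openin (Euclidean_space n) S"
    and H: "\<And>m t. (H m has_real_derivative a m * H (m + 1) t + H (m + 2) t) (at t)"
    and "Ck_on n k S f"
  shows "Ck_on n k S (\<lambda>x. H m (f x))"
  using assms(3)
proof (induction k arbitrary: m)
  have H_cont: "continuous_on UNIV (H m)" for m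
    using H by (meson DERIV_isCont continuous_at_imp_continuous_on)
  {
    case 0
    then have "continuous_on S f"
      using S by (simp add: continuous_map_Euclidean_subspace_iff)
    then have "continuous_on S (\<lambda>x. H m (f x))"
      by (rule continuous_on_compose2[OF H_cont]) auto
    then show ?case
      using S by (simp add: continuous_map_Euclidean_subspace_iff)
  next
    case (Suc k)
    show ?case
    proof (rule Ck_on_SucI[OF S, where
          G = "\<lambda>i x. (a m * H (m + 1) (f x) + H (m + 2) (f x)) * partial_deriv i f x"])
      show "continuous_on S (\<lambda>x. H m (f x))"
        using Ck_on_continuous_on[OF S Suc.prems] by (rule continuous_on_compose2[OF H_cont]) auto
      show "((\<lambda>t. H m (f (x(i := t)))) has_real_derivative
          (a m * H (m + 1) (f x) + H (m + 2) (f x)) * partial_deriv i f x) (at (x i))"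
        if "x \<in> S" "i < n" for x i
        using DERIV_chain2[OF _ Ck_on_Suc_has_partial_deriv[OF Suc.prems that], of "H m"] H[of m "f x"]
        by (simp only: fun_upd_triv)
      show "Ck_on n k S (\<lambda>x. (a m * H (m + 1) (f x) + H (m + 2) (f x)) * partial_deriv i f x)"
        if "i < n" for i
        using Suc.prems that Ck_on_SucD[OF S Suc.prems]
        by (intro Ck_on_add Ck_on_mult Ck_on_const Suc.IH S) auto
    qed
  }
qed

lemma Ck_on_subset:
  assumes "openin (Euclidean_space n) S" "openin (Euclidean_space n) T" "T \<subseteq> S" "Ck_on n k S f"
  shows "Ck_on n k T f"
  using assms(4)
proof (induction k arbitrary: f)
  case 0
  then show ?case
    using assms by (auto simp: continuous_map_Euclidean_subspace_iff intro: continuous_on_subset)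
next
  case (Suc k)
  then show ?case
    using assms by (auto simp: continuous_map_Euclidean_subspace_iff intro: continuous_on_subset)
qed

text \<open>Continuity is pasted from an open cover, and the existence of partial derivatives is a pointwise matter.\<close>

lemma Ck_on_local:
  assumes S: "openin (Euclidean_space n) S"
    and "\<And>x. x \<in> S \<Longrightarrow> \<exists>T. openin (Euclidean_space n) T \<and> x \<in> T \<and> T \<subseteq> S \<and> Ck_on n k T f"
  shows "Ck_on n k S f"
  using assms(2)
proof (induction k arbitrary: f)
  have cont: "continuous_on S h"
    if loc: "\<And>x. x \<in> S \<Longrightarrow> \<exists>T. openin (Euclidean_space n) T \<and> x \<in> T \<and> T \<subseteq> S \<and> continuous_on T h"
    for h :: "(nat \<Rightarrow> real) \<Rightarrow> real"
  proof -
    have "continuous_map (subtopology (Euclidean_space n) S) euclideanreal h"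
    proof (rule pasting_lemma[where I = "{T. openin (Euclidean_space n) T \<and> T \<subseteq> S \<and> continuous_on T h}"
          and T = "\<lambda>T. T" and f = "\<lambda>_. h"])
      fix T assume T: "T \<in> {T. openin (Euclidean_space n) T \<and> T \<subseteq> S \<and> continuous_on T h}"
      show "openin (subtopology (Euclidean_space n) S) T"
        using T S by (auto simp: openin_open_subtopology)
      show "continuous_map (subtopology (subtopology (Euclidean_space n) S) T) euclideanreal h"
        using T continuous_map_Euclidean_subspace_iff[of n T h]
        by (simp add: subtopology_subtopology Int_absorb1)
    qed (use loc in auto)
    then show ?thesis
      using S by (simp add: continuous_map_Euclidean_subspace_iff)
  qed
  {
    case 0
    then have "continuous_on S f"
      by (intro cont) (meson Ck_on_continuous_on)
    then show ?case
      using S by (simp add: continuous_map_Euclidean_subspace_iff)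
  next
    case (Suc k)
    have "continuous_on S f"
      using Suc.prems by (intro cont) (meson Ck_on_continuous_on)
    moreover have "(\<lambda>t. f (x(i := t))) field_differentiable (at (x i))" if "x \<in> S" "i < n" for x i
      using Suc.prems[OF that(1)] that(2) by auto
    moreover have "Ck_on n k S (partial_deriv i f)" if "i < n" for i
    proof (rule Suc.IH)
      show "\<exists>T. openin (Euclidean_space n) T \<and> x \<in> T \<and> T \<subseteq> S \<and> Ck_on n k T (partial_deriv i f)"
        if "x \<in> S" for x
        using Suc.prems[OF that] \<open>i < n\<close> by auto
    qed
    ultimately show ?case
      using S by (auto simp: continuous_map_Euclidean_subspace_iff)
  }
qed

lemma Cinf_on_local:
  assumes "openin (Euclidean_space n) S"
    and "\<And>x. x \<in> S \<Longrightarrow> \<exists>T. openin (Euclidean_space n) T \<and> x \<in> T \<and> T \<subseteq> S \<and> Cinf_on n T f"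
  shows "Cinf_on n S f"
  unfolding Cinf_on_def
proof
  fix k
  show "Ck_on n k S f"
  proof (rule Ck_on_local[OF assms(1)])
    fix x assume "x \<in> S"
    then obtain T where "openin (Euclidean_space n) T" "x \<in> T" "T \<subseteq> S" "Cinf_on n T f"
      using assms(2) by meson
    then show "\<exists>T. openin (Euclidean_space n) T \<and> x \<in> T \<and> T \<subseteq> S \<and> Ck_on n k T f"
      unfolding Cinf_on_def by meson
  qed
qed

section \<open>Flat functions and plateaus on the real line\<close>

text \<open>For \<open>m = 0\<close> this is the standard smooth function that vanishes exactly on the
  nonpositive half line. The powers of \<open>1 / t\<close> make the family closed under differentiation in the
  sense of \<open>Ck_on_compose\<close>.\<close>

definition flat :: "nat \<Rightarrow> real \<Rightarrow> real" where
  "flat m t = (if t \<le> 0 then 0 else (1 / t) ^ m * exp (- (1 / t)))"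

lemma flat_tendsto_0: "(flat m \<longlongrightarrow> 0) (at 0)"
proof -
  have "((\<lambda>t::real. (1 / t) ^ m / exp (1 / t)) \<longlongrightarrow> 0) (at_right 0)"
    using filterlim_compose[OF tendsto_power_div_exp_0 filterlim_inverse_at_top_right]
    by (simp add: inverse_eq_divide)
  then have "(flat m \<longlongrightarrow> 0) (at_right 0)"
    by (rule Lim_transform_eventually)
       (auto simp: flat_def exp_minus divide_inverse eventually_at_filter)
  moreover have "(flat m \<longlongrightarrow> 0) (at_left 0)"
    by (rule tendsto_eventually) (auto simp: flat_def eventually_at_filter)
  ultimately show ?thesis
    by (simp add: filterlim_at_split)
qed

lemma flat_has_real_derivative:
  "(flat m has_real_derivative - real m * flat (m + 1) t + flat (m + 2) t) (at t)"
proof -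
  consider "t < 0" | "t = 0" | "t > 0" by linarith
  then show ?thesis
  proof cases
    case 1
    have "((\<lambda>t. 0) has_real_derivative 0) (at t)" by simp
    then have "(flat m has_real_derivative 0) (at t)"
      by (rule has_field_derivative_transform_within_open[where S = "{..<0}"])
         (use 1 in \<open>auto simp: flat_def\<close>)
    then show ?thesis
      using 1 by (simp add: flat_def)
  next
    case 2
    \<comment> \<open>The difference quotient of \<open>flat m\<close> at \<open>0\<close> is \<open>flat (Suc m)\<close>.\<close>
    have "((\<lambda>h. flat (Suc m) h) \<longlongrightarrow> 0) (at 0)"
      by (rule flat_tendsto_0)
    then have "((\<lambda>h. (flat m (0 + h) - flat m 0) / h) \<longlongrightarrow> 0) (at 0)"
      by (rule Lim_transform_eventually) (auto simp: flat_def eventually_at_filter)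
    then show ?thesis
      using 2 by (simp add: DERIV_def flat_def)
  next
    case 3
    have u: "((\<lambda>t. 1 / t) has_real_derivative - ((1 / t) ^ 2)) (at t)"
      using 3 by (auto intro!: derivative_eq_intros simp: power2_eq_square)
    have pow: "((\<lambda>t. (1 / t) ^ m) has_real_derivative - real m * (1 / t) ^ (m + 1)) (at t)"
    proof -
      have "real m * (- (c ^ 2) * c ^ (m - Suc 0)) = - real m * c ^ (m + 1)" for c :: real
        by (cases m) (simp_all add: power2_eq_square algebra_simps)
      then show ?thesis
        using DERIV_power[OF u, of m] by (simp only:)
    qed
    have exp: "((\<lambda>t. exp (- (1 / t))) has_real_derivative exp (- (1 / t)) * (1 / t) ^ 2) (at t)"
      using DERIV_chain2[OF DERIV_exp DERIV_minus[OF u]] by simp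
    have "- real m * (1 / t) ^ (m + 1) * exp (- (1 / t)) + exp (- (1 / t)) * (1 / t) ^ 2 * (1 / t) ^ m
        = - real m * flat (m + 1) t + flat (m + 2) t"
      using 3 by (simp add: flat_def power2_eq_square mult_ac)
    then have "((\<lambda>t. (1 / t) ^ m * exp (- (1 / t))) has_real_derivative
        - real m * flat (m + 1) t + flat (m + 2) t) (at t)"
      using DERIV_mult[OF pow exp] by (simp only:)
    then show ?thesis
      by (rule has_field_derivative_transform_within_open[where S = "{0<..}"])
         (use 3 in \<open>auto simp: flat_def\<close>)
  qed
qed

text \<open>A smooth function that falls from \<open>1\<close> at \<open>0\<close> to \<open>0\<close> at \<open>1\<close>. The outer \<open>flat 0\<close> sees the constant
  \<open>flat 0 1\<close> for \<open>s \<le> 0\<close>, and a nonpositive argument once \<open>flat 0 s\<close> has reached \<open>flat 0 1\<close>. Being made by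
  composition instead of the usual quotient, it is covered by \<open>Ck_on_compose\<close>.\<close>

definition plateau :: "real \<Rightarrow> real" where
  "plateau s = flat 0 (flat 0 1 - flat 0 s) / flat 0 (flat 0 1)"

lemma plateau_eq_1: "s \<le> 0 \<Longrightarrow> plateau s = 1"
  by (simp add: plateau_def flat_def)

lemma plateau_eq_0: "s \<ge> 1 \<Longrightarrow> plateau s = 0"
  by (simp add: plateau_def flat_def)

lemma Ck_on_plateau:
  assumes S: "openin (Euclidean_space n) S" and f: "Ck_on n k S f"
  shows "Ck_on n k S (\<lambda>x. plateau (f x))"
proof -
  note flat = Ck_on_compose[OF S flat_has_real_derivative]
  have "Ck_on n k S (\<lambda>x. (1 / flat 0 (flat 0 1)) * flat 0 (flat 0 1 + (- 1) * flat 0 (f x)))"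
    by (intro Ck_on_mult[OF S] Ck_on_add[OF S] Ck_on_const[OF S] flat f)
  then show ?thesis
    by (simp add: plateau_def)
qed

section \<open>Smooth functions on a manifold\<close>

locale smooth_mfd =
  fixes M :: "'m::{t2_space,second_countable_topology} mfd"
  assumes is_manifold: "smooth_manifold M"
begin

lemma chart_open: "(U, \<phi>) \<in> atlas M \<Longrightarrow> open U"
  using is_manifold by (auto simp: smooth_manifold_def)

lemma chart_homeomorphic_map:
  "(U, \<phi>) \<in> atlas M \<Longrightarrow>
     homeomorphic_map (top_of_set U) (subtopology (Euclidean_space (mdim M)) (\<phi> ` U)) \<phi>"
  using is_manifold by (auto simp: smooth_manifold_def)

lemma chart_inj_on:
  assumes "(U, \<phi>) \<in> atlas M"
  shows "inj_on \<phi> U"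
  using homeomorphic_imp_injective_map[OF chart_homeomorphic_map[OF assms]] by simp

lemma chart_image_openin:
  assumes U: "(U, \<phi>) \<in> atlas M" and W: "open W"
  shows "openin (Euclidean_space (mdim M)) (\<phi> ` (U \<inter> W))"
proof -
  have "openin (subtopology (Euclidean_space (mdim M)) (\<phi> ` U)) (\<phi> ` (U \<inter> W))"
    using homeomorphic_map_openness[OF chart_homeomorphic_map[OF U], of "U \<inter> W"] W by auto
  moreover have "openin (Euclidean_space (mdim M)) (\<phi> ` U)"
    using is_manifold U by (auto simp: smooth_manifold_def)
  ultimately show ?thesis
    by (rule openin_trans_full)
qed

lemma ex_chart: obtains U \<phi> where "(U, \<phi>) \<in> atlas M" "p \<in> U"
proof -
  have "p \<in> (\<Union>(U, \<phi>)\<in>atlas M. U)"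
    using is_manifold by (auto simp: smooth_manifold_def)
  then show ?thesis
    using that by auto
qed

lemma smooth_fun_on_const: "open W \<Longrightarrow> smooth_fun_on M W (\<lambda>q. c)"
  by (auto simp: smooth_fun_on_def Cinf_on_def intro: Ck_on_const chart_image_openin)

lemma smooth_fun_on_add:
  "open W \<Longrightarrow> smooth_fun_on M W f \<Longrightarrow> smooth_fun_on M W g \<Longrightarrow> smooth_fun_on M W (\<lambda>q. f q + g q)"
  unfolding smooth_fun_on_def Cinf_on_def
  by (fast intro: Ck_on_add chart_image_openin)

lemma smooth_fun_on_mult:
  "open W \<Longrightarrow> smooth_fun_on M W f \<Longrightarrow> smooth_fun_on M W g \<Longrightarrow> smooth_fun_on M W (\<lambda>q. f q * g q)"
  unfolding smooth_fun_on_def Cinf_on_def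
  by (fast intro: Ck_on_mult chart_image_openin)

lemma smooth_fun_on_plateau:
  "open W \<Longrightarrow> smooth_fun_on M W f \<Longrightarrow> smooth_fun_on M W (\<lambda>q. plateau (f q))"
  unfolding smooth_fun_on_def Cinf_on_def
  by (fast intro: Ck_on_plateau chart_image_openin)

lemma smooth_fun_on_sum:
  assumes "open W" "\<And>i. i \<in> J \<Longrightarrow> smooth_fun_on M W (f i)"
  shows "smooth_fun_on M W (\<lambda>q. \<Sum>i\<in>J. f i q)"
  using assms by (induction J rule: infinite_finite_induct)
    (auto intro: smooth_fun_on_const smooth_fun_on_add)

lemma smooth_fun_on_diff:
  assumes "open W" "smooth_fun_on M W f" "smooth_fun_on M W g"
  shows "smooth_fun_on M W (\<lambda>q. f q - g q)"
  using smooth_fun_on_add[OF assms(1,2) smooth_fun_on_mult[OF assms(1)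
        smooth_fun_on_const[OF assms(1), of "-1"] assms(3)]] by simp

lemma smooth_fun_on_subset:
  assumes "open W" "open W'" "W' \<subseteq> W" "smooth_fun_on M W f"
  shows "smooth_fun_on M W' f"
  unfolding smooth_fun_on_def
proof clarify
  fix U \<phi> assume U: "(U, \<phi>) \<in> atlas M"
  show "Cinf_on (mdim M) (\<phi> ` (U \<inter> W')) (\<lambda>x. f (inv_into U \<phi> x))"
    unfolding Cinf_on_def
  proof
    fix k
    have "Ck_on (mdim M) k (\<phi> ` (U \<inter> W)) (\<lambda>x. f (inv_into U \<phi> x))"
      using assms(4) U by (auto simp: smooth_fun_on_def Cinf_on_def)
    then show "Ck_on (mdim M) k (\<phi> ` (U \<inter> W')) (\<lambda>x. f (inv_into U \<phi> x))"
      by (rule Ck_on_subset[rotated 3])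
         (use assms U in \<open>auto intro: chart_image_openin\<close>)
  qed
qed

lemma smooth_fun_on_cong:
  assumes "open W" "smooth_fun_on M W f" "\<And>q. q \<in> W \<Longrightarrow> f q = g q"
  shows "smooth_fun_on M W g"
  unfolding smooth_fun_on_def
proof clarify
  fix U \<phi> assume U: "(U, \<phi>) \<in> atlas M"
  show "Cinf_on (mdim M) (\<phi> ` (U \<inter> W)) (\<lambda>x. g (inv_into U \<phi> x))"
    unfolding Cinf_on_def
  proof
    fix k
    have "Ck_on (mdim M) k (\<phi> ` (U \<inter> W)) (\<lambda>x. f (inv_into U \<phi> x))"
      using assms(2) U by (auto simp: smooth_fun_on_def Cinf_on_def)
    then show "Ck_on (mdim M) k (\<phi> ` (U \<inter> W)) (\<lambda>x. g (inv_into U \<phi> x))"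
      by (rule Ck_on_cong[OF chart_image_openin[OF U \<open>open W\<close>]])
         (use assms(3) chart_inj_on[OF U] in auto)
  qed
qed

lemma smooth_fun_on_local:
  assumes W: "open W"
    and loc: "\<And>p. p \<in> W \<Longrightarrow> \<exists>W'. open W' \<and> p \<in> W' \<and> smooth_fun_on M W' f"
  shows "smooth_fun_on M W f"
  unfolding smooth_fun_on_def
proof clarify
  fix U \<phi> assume U: "(U, \<phi>) \<in> atlas M"
  show "Cinf_on (mdim M) (\<phi> ` (U \<inter> W)) (\<lambda>x. f (inv_into U \<phi> x))"
  proof (rule Cinf_on_local[OF chart_image_openin[OF U W]])
    fix x assume "x \<in> \<phi> ` (U \<inter> W)"
    then obtain p where p: "p \<in> U" "p \<in> W" "x = \<phi> p" by auto
    obtain W' where W': "open W'" "p \<in> W'" "smooth_fun_on M W' f"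
      using loc[OF p(2)] by blast
    have "smooth_fun_on M (W \<inter> W') f"
      using W' W by (intro smooth_fun_on_subset[OF _ _ _ W'(3)]) auto
    then have "Cinf_on (mdim M) (\<phi> ` (U \<inter> (W \<inter> W'))) (\<lambda>x. f (inv_into U \<phi> x))"
      using U by (auto simp: smooth_fun_on_def)
    moreover have "openin (Euclidean_space (mdim M)) (\<phi> ` (U \<inter> (W \<inter> W')))"
      using W W' by (intro chart_image_openin[OF U]) auto
    ultimately show "\<exists>T. openin (Euclidean_space (mdim M)) T \<and> x \<in> T \<and> T \<subseteq> \<phi> ` (U \<inter> W) \<and>
        Cinf_on (mdim M) T (\<lambda>x. f (inv_into U \<phi> x))"
      using p W' by (intro exI[of _ "\<phi> ` (U \<inter> (W \<inter> W'))"]) auto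
  qed
qed

lemma smooth_fun_on_chart_component:
  assumes "(U, \<phi>) \<in> atlas M" "i < mdim M"
  shows "smooth_fun_on M U (\<lambda>q. \<phi> q i)"
  using is_manifold assms unfolding smooth_manifold_def smooth_fun_on_def by fast

lemma Cinf_smooth_fun_on: "f \<in> Cinf M \<Longrightarrow> open W \<Longrightarrow> smooth_fun_on M W f"
  by (auto simp: Cinf_def intro: smooth_fun_on_subset[of UNIV])

lemma CinfI_local: "(\<And>p. \<exists>W. open W \<and> p \<in> W \<and> smooth_fun_on M W f) \<Longrightarrow> f \<in> Cinf M"
  by (auto simp: Cinf_def intro: smooth_fun_on_local)

lemma Cinf_add: "f \<in> Cinf M \<Longrightarrow> g \<in> Cinf M \<Longrightarrow> f + g \<in> Cinf M"
  and Cinf_diff: "f \<in> Cinf M \<Longrightarrow> g \<in> Cinf M \<Longrightarrow> f - g \<in> Cinf M"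
  and Cinf_mult: "f \<in> Cinf M \<Longrightarrow> g \<in> Cinf M \<Longrightarrow> f * g \<in> Cinf M"
  and Cinf_const: "(\<lambda>q. c) \<in> Cinf M"
  by (auto simp: Cinf_def plus_fun_def times_fun_def fun_diff_def
      intro: smooth_fun_on_add smooth_fun_on_diff smooth_fun_on_mult smooth_fun_on_const)

lemma Cinf_sum: "(\<And>i. i \<in> J \<Longrightarrow> f i \<in> Cinf M) \<Longrightarrow> (\<Sum>i\<in>J. f i) \<in> Cinf M"
  using Cinf_const[of 0]
  by (induction J rule: infinite_finite_induct) (auto intro: Cinf_add simp: zero_fun_def)

lemma Cinf_smooth_near: "f \<in> Cinf M \<Longrightarrow> smooth_near M p f"
  by (auto simp: Cinf_def smooth_near_def)

text \<open>A box with centre \<open>\<phi> p\<close> is compact, hence so is its preimage in the chart; that this preimage is closed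
  in the whole manifold, not only in \<open>U\<close>, is where the Hausdorff property is used.\<close>

lemma closed_box_in_chart:
  assumes U: "(U, \<phi>) \<in> atlas M" and W: "open W" "p \<in> U \<inter> W"
  obtains d where "d > 0" "closed {q \<in> U. \<forall>i<mdim M. \<bar>\<phi> q i - \<phi> p i\<bar> \<le> d}"
    "{q \<in> U. \<forall>i<mdim M. \<bar>\<phi> q i - \<phi> p i\<bar> \<le> d} \<subseteq> W"
proof -
  define n where "n = mdim M"
  let ?E = "topspace (Euclidean_space n)"
  have S: "openin (Euclidean_space n) (\<phi> ` (U \<inter> W))"
    using chart_image_openin[OF U W(1)] by (simp add: n_def)
  then obtain T where T: "open T" "\<phi> ` (U \<inter> W) = ?E \<inter> T"
    by (subst (asm) Euclidean_space_eq_top_of_set) (auto simp: openin_open)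
  have "\<phi> p \<in> T" using T W by blast
  have "openin (product_topology (\<lambda>_. euclideanreal) UNIV) T"
    using T(1) by (simp add: euclidean_product_topology)
  from product_topology_open_contains_basis[OF this \<open>\<phi> p \<in> T\<close>]
  obtain X where X: "\<phi> p \<in> Pi\<^sub>E UNIV X" "\<And>i. open (X i)" "Pi\<^sub>E UNIV X \<subseteq> T"
    by auto
  have "\<exists>e>0. cball (\<phi> p i) e \<subseteq> X i" for i
    using X(1) X(2)[of i] by (auto simp: open_contains_cball PiE_iff)
  then obtain e where e: "\<And>i. e i > 0" "\<And>i. cball (\<phi> p i) (e i) \<subseteq> X i" by metis
  define d where "d = Min (insert 1 (e ` {..<n}))"
  have d: "d > 0" "\<And>i. i < n \<Longrightarrow> d \<le> e i"
    using e by (auto simp: d_def)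
  define B where "B = Pi\<^sub>E UNIV (\<lambda>i. if i < n then cball (\<phi> p i) d else {0})"
  have "compactin (product_topology (\<lambda>i. euclideanreal) UNIV) B"
    unfolding B_def compactin_PiE by auto
  then have "compact B"
    by (simp add: euclidean_product_topology)
  have phi_E: "\<phi> q \<in> ?E" if "q \<in> U" for q
    using openin_subset[OF chart_image_openin[OF U open_UNIV]] that by (auto simp: n_def)
  have B: "B \<subseteq> \<phi> ` (U \<inter> W)"
  proof
    fix x assume x: "x \<in> B"
    have "x i \<in> X i" for i
    proof (cases "i < n")
      case True
      then have "x i \<in> cball (\<phi> p i) d"
        using PiE_mem[OF x[unfolded B_def], of i] by simp
      then show ?thesis
        using e(2)[of i] d(2)[OF True] by auto
    next
      case False
      then have "x i = 0" "\<phi> p i = 0"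
        using PiE_mem[OF x[unfolded B_def], of i] phi_E[of p] W by (auto simp: topspace_Euclidean_space)
      then show ?thesis
        using PiE_mem[OF X(1), of i] by simp
    qed
    moreover have "x i = 0" if "i \<ge> n" for i
      using PiE_mem[OF x[unfolded B_def], of i] that by simp
    ultimately show "x \<in> \<phi> ` (U \<inter> W)"
      using X(3) T(2) by (auto simp: PiE_iff topspace_Euclidean_space)
  qed
  obtain h where h: "homeomorphic_maps (top_of_set U) (subtopology (Euclidean_space n) (\<phi> ` U)) \<phi> h"
    using chart_homeomorphic_map[OF U] by (auto simp: homeomorphic_map_maps n_def)
  have h_phi: "h (\<phi> q) = q" if "q \<in> U" for q
    using h that by (auto simp: homeomorphic_maps_def)
  have "subtopology (Euclidean_space n) (\<phi> ` U) = top_of_set (\<phi> ` U)"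
    using phi_E by (intro subtopology_Euclidean_space_eq) auto
  then have "continuous_on (\<phi> ` U) h"
    using h by (simp add: homeomorphic_maps_def continuous_map_in_subtopology)
  then have "compact (h ` B)"
    using \<open>compact B\<close> B by (intro compact_continuous_image) (auto intro: continuous_on_subset)
  have "h ` B = {q \<in> U. \<forall>i<n. \<bar>\<phi> q i - \<phi> p i\<bar> \<le> d}"
  proof (intro set_eqI iffI)
    fix q assume "q \<in> h ` B"
    then obtain r where r: "r \<in> U" "\<phi> r \<in> B" "q = h (\<phi> r)" using B by auto
    have "\<phi> r i \<in> cball (\<phi> p i) d" if "i < n" for i
      using PiE_mem[OF r(2)[unfolded B_def], of i] that by simp
    then show "q \<in> {q \<in> U. \<forall>i<n. \<bar>\<phi> q i - \<phi> p i\<bar> \<le> d}"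
      using r h_phi by (auto simp: dist_real_def abs_minus_commute)
  next
    fix q assume q: "q \<in> {q \<in> U. \<forall>i<n. \<bar>\<phi> q i - \<phi> p i\<bar> \<le> d}"
    then have "\<phi> q \<in> B"
      using phi_E[of q] by (auto simp: B_def PiE_iff dist_real_def abs_minus_commute topspace_Euclidean_space)
    then show "q \<in> h ` B"
      using h_phi q by (metis (lifting) image_eqI mem_Collect_eq)
  qed
  moreover have "h ` B \<subseteq> W"
    using B h_phi by auto
  ultimately show ?thesis
    using that[of d] d(1) compact_imp_closed[OF \<open>compact (h ` B)\<close>] by (simp add: n_def)
qed

text \<open>The cutoff is a plateau function of the squared distance to \<open>p\<close> in a chart, extended by \<open>0\<close>. The extension
  is smooth because the chart and the complement of the closed set \<open>K\<close> cover the manifold.\<close>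

lemma ex_cutoff:
  assumes W: "open W" "p \<in> W"
  obtains \<beta> N K where "\<beta> \<in> Cinf M" "open N" "p \<in> N" "closed K" "K \<subseteq> W"
    "\<And>q. q \<in> N \<Longrightarrow> \<beta> q = 1" "\<And>q. q \<notin> K \<Longrightarrow> \<beta> q = 0"
proof -
  obtain U \<phi> where U: "(U, \<phi>) \<in> atlas M" "p \<in> U" by (rule ex_chart)
  note oU = chart_open[OF U(1)]
  define n where "n = mdim M"
  obtain d where d: "d > 0" "closed {q \<in> U. \<forall>i<n. \<bar>\<phi> q i - \<phi> p i\<bar> \<le> d}"
    "{q \<in> U. \<forall>i<n. \<bar>\<phi> q i - \<phi> p i\<bar> \<le> d} \<subseteq> W"
    using closed_box_in_chart[OF U(1) W(1)] U W unfolding n_def by blast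
  define K where "K = {q \<in> U. \<forall>i<n. \<bar>\<phi> q i - \<phi> p i\<bar> \<le> d}"
  \<comment> \<open>\<open>s\<close> is at most \<open>0\<close> where the squared distance is at most \<open>d\<^sup>2 / 2\<close>, and at least \<open>1\<close> where it is at
    least \<open>d\<^sup>2\<close>, in particular on \<open>U - K\<close>.\<close>
  define s where "s q = 2 / d\<^sup>2 * (\<Sum>i<n. (\<phi> q i - \<phi> p i) * (\<phi> q i - \<phi> p i)) - 1" for q
  define \<beta> where "\<beta> q = (if q \<in> U then plateau (s q) else 0)" for q
  define N where "N = s -` {..<0} \<inter> U"
  have K0: "\<beta> q = 0" if q: "q \<notin> K" for q
  proof (cases "q \<in> U")
    case True
    then obtain i where i: "i < n" "\<bar>\<phi> q i - \<phi> p i\<bar> > d"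
      using q by (auto simp: K_def not_le)
    have "d\<^sup>2 \<le> (\<phi> q i - \<phi> p i) * (\<phi> q i - \<phi> p i)"
      using i(2) d(1) abs_le_square_iff[of d "\<phi> q i - \<phi> p i"] by (simp add: power2_eq_square)
    also have "\<dots> \<le> (\<Sum>i<n. (\<phi> q i - \<phi> p i) * (\<phi> q i - \<phi> p i))"
      using i(1) by (intro member_le_sum) auto
    finally have "s q \<ge> 1"
      using d(1) by (simp add: s_def field_simps)
    then show ?thesis
      by (simp add: \<beta>_def plateau_eq_0)
  qed (simp add: \<beta>_def)
  have s_smooth: "smooth_fun_on M U s"
    unfolding s_def n_def
    by (intro smooth_fun_on_diff smooth_fun_on_mult smooth_fun_on_sum smooth_fun_on_const oU
        smooth_fun_on_chart_component[OF U(1)]) auto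
  have "\<beta> \<in> Cinf M"
  proof (rule CinfI_local)
    fix q
    show "\<exists>W. open W \<and> q \<in> W \<and> smooth_fun_on M W \<beta>"
    proof (cases "q \<in> U")
      case True
      have "smooth_fun_on M U \<beta>"
        by (rule smooth_fun_on_cong[OF oU smooth_fun_on_plateau[OF oU s_smooth]]) (simp add: \<beta>_def)
      then show ?thesis using True oU by blast
    next
      case False
      have "open (- K)" "q \<in> - K" using False d(2) by (auto simp: K_def)
      moreover have "smooth_fun_on M (- K) \<beta>"
        by (rule smooth_fun_on_cong[OF \<open>open (- K)\<close> smooth_fun_on_const[OF \<open>open (- K)\<close>, of 0]])
           (simp add: K0)
      ultimately show ?thesis by blast
    qed
  qed
  moreover have "open N"
  proof -
    have "continuous_on U \<phi>"
      using homeomorphic_imp_continuous_map[OF chart_homeomorphic_map[OF U(1)]]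
      by (simp add: Euclidean_space_def continuous_map_in_subtopology euclidean_product_topology)
    then have "continuous_on U s"
      unfolding s_def by (intro continuous_on_diff continuous_on_mult continuous_on_sum
          continuous_on_const continuous_on_product_then_coordinatewise[of U \<phi>])
    then show ?thesis
      unfolding N_def using oU by (simp add: continuous_on_open_vimage)
  qed
  moreover have "p \<in> N" using U by (simp add: N_def s_def)
  ultimately show ?thesis
    using that[of \<beta> N K] d K0 by (auto simp: K_def N_def \<beta>_def plateau_eq_1)
qed

text \<open>The product vanishes off the closed set \<open>K\<close>, hence near every point outside \<open>W\<close>, whatever \<open>f\<close> is there.\<close>

lemma cutoff_mult_Cinf:
  assumes \<beta>: "\<beta> \<in> Cinf M" "closed K" "K \<subseteq> W" "\<And>q. q \<notin> K \<Longrightarrow> \<beta> q = 0"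
    and W: "open W" and f: "smooth_fun_on M W f"
  shows "(\<lambda>q. \<beta> q * f q) \<in> Cinf M"
proof (rule CinfI_local)
  fix q
  show "\<exists>V. open V \<and> q \<in> V \<and> smooth_fun_on M V (\<lambda>q. \<beta> q * f q)"
  proof (cases "q \<in> W")
    case True
    then show ?thesis
      using W Cinf_smooth_fun_on[OF \<beta>(1) W] f by (intro exI[of _ W] conjI smooth_fun_on_mult)
  next
    case False
    have o: "open (- K)" "q \<in> - K" using False \<beta> by auto
    have "smooth_fun_on M (- K) (\<lambda>q. \<beta> q * f q)"
      by (rule smooth_fun_on_cong[OF o(1) smooth_fun_on_const[OF o(1), of 0]]) (simp add: \<beta>)
    then show ?thesis using o by blast
  qed
qed

lemma smooth_near_extend:
  assumes "smooth_near M p f"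
  obtains F N where "F \<in> Cinf M" "open N" "p \<in> N" "\<And>q. q \<in> N \<Longrightarrow> F q = f q"
proof -
  obtain W where W: "open W" "p \<in> W" "smooth_fun_on M W f"
    using assms by (auto simp: smooth_near_def)
  obtain \<beta> N K where \<beta>: "\<beta> \<in> Cinf M" "open N" "p \<in> N" "closed K" "K \<subseteq> W"
    "\<And>q. q \<in> N \<Longrightarrow> \<beta> q = 1" "\<And>q. q \<notin> K \<Longrightarrow> \<beta> q = 0"
    using ex_cutoff[OF W(1,2)] by blast
  show ?thesis
    by (rule that[of "\<lambda>q. \<beta> q * f q" N]) (use \<beta> W cutoff_mult_Cinf[OF \<beta>(1,4,5,7) W(1,3)] in auto)
qed

lemma smooth_near_cong:
  assumes "smooth_near M p f" "open N" "p \<in> N" "\<And>q. q \<in> N \<Longrightarrow> f q = g q"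
  shows "smooth_near M p g"
proof -
  obtain W where W: "open W" "p \<in> W" "smooth_fun_on M W f"
    using assms by (auto simp: smooth_near_def)
  have "smooth_fun_on M (W \<inter> N) f"
    using W assms by (intro smooth_fun_on_subset[OF W(1) _ _ W(3)]) auto
  then have "smooth_fun_on M (W \<inter> N) g"
    by (rule smooth_fun_on_cong[rotated]) (use W assms in auto)
  then show ?thesis
    using W assms by (auto simp: smooth_near_def)
qed

text \<open>Multiplying by the indicator function of \<open>N\<close> erases everything off \<open>N\<close>; the Leibniz rule shows
  that a derivation at \<open>p\<close> kills this idempotent, hence does not notice the multiplication.\<close>

lemma tangent_vector_germ:
  assumes v: "v \<in> tangent_space M p" and N: "open N" "p \<in> N"
    and eq: "\<And>q. q \<in> N \<Longrightarrow> f q = g q"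
  shows "v f = v g"
proof -
  define i where "i = (indicator N :: 'm \<Rightarrow> real)"
  have i: "smooth_near M p i"
    by (rule smooth_near_cong[OF Cinf_smooth_near[OF Cinf_const[of 1]] N]) (simp add: i_def)
  have prod: "v (h * k) = h p * v k + k p * v h" if "smooth_near M p h" "smooth_near M p k" for h k
    using v that by (simp add: tangent_space_def)
  have "i p = 1" "i * i = i"
    using N by (auto simp: i_def fun_eq_iff indicator_def)
  then have i0: "v i = 0"
    using prod[OF i i] by simp
  have mult_i: "v h = v (h * i)" if "smooth_near M p h" for h
    using prod[OF that i] i0 \<open>i p = 1\<close> by simp
  have fg: "f * i = g * i"
    using eq by (auto simp: fun_eq_iff i_def indicator_def)
  have "smooth_near M p f \<longleftrightarrow> smooth_near M p g"
    using smooth_near_cong[OF _ N] eq by metis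
  then show ?thesis
    using v mult_i[of f] mult_i[of g] fg by (cases "smooth_near M p f") (auto simp: tangent_space_def)
qed

end

section \<open>Sections of vector bundles and their duals\<close>

lemma linear_on_subspace_0:
  assumes "linear_on_subspace S h" "subspace S"
  shows "h 0 = 0"
proof -
  have "h (0 *\<^sub>R 0) = 0 *\<^sub>R h 0"
    using assms subspace_0 unfolding linear_on_subspace_def by blast
  then show ?thesis by simp
qed

lemma linear_on_subspace_sum:
  assumes h: "linear_on_subspace S h" and S: "subspace S" and x: "\<And>j. j \<in> J \<Longrightarrow> x j \<in> S"
  shows "h (\<Sum>j\<in>J. c j *\<^sub>R x j) = (\<Sum>j\<in>J. c j *\<^sub>R h (x j))"
  using x
proof (induction J rule: infinite_finite_induct)
  case (insert j J)
  have "c j *\<^sub>R x j \<in> S" "(\<Sum>j\<in>J. c j *\<^sub>R x j) \<in> S"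
    using insert S by (auto intro!: subspace_sum subspace_scale)
  then have "h (c j *\<^sub>R x j + (\<Sum>j\<in>J. c j *\<^sub>R x j)) = c j *\<^sub>R h (x j) + h (\<Sum>j\<in>J. c j *\<^sub>R x j)"
    using h insert unfolding linear_on_subspace_def by simp
  then show ?case using insert by simp
qed (use linear_on_subspace_0[OF h S] in auto)

lemma fun_smult_apply [simp]: "(f \<odot> X) p = f p *\<^sub>R X p"
  by (simp add: fun_smult_def)

lemma pairing_apply [simp]: "\<langle>X, \<zeta>\<rangle> p = \<zeta> p (X p)"
  by (simp add: pairing_def)

lemma vf_apply_apply [simp]: "vf_apply V f p = V p f"
  by (simp add: vf_apply_def)

lemma on_sections_apply: "on_sections h X p = h p (X p)"
  by (simp add: on_sections_def)

lemma sections_dual_bundle_iff: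
  "\<zeta> \<in> sections M (dual_bundle E) \<longleftrightarrow>
     (\<forall>p. linear_on_subspace (fibre E p) (\<zeta> p) \<and> (\<forall>x. x \<notin> fibre E p \<longrightarrow> \<zeta> p x = 0)) \<and>
     (\<forall>(U, \<Phi>)\<in>trivs E. \<forall>j<rank E. smooth_fun_on M U (\<lambda>p. \<zeta> p (local_frame E \<Phi> j p)))"
  by (fastforce simp: sections_def dual_bundle_def)

lemma unit_vec_in_Euclidean_space: "j < n \<Longrightarrow> unit_vec j \<in> topspace (Euclidean_space n)"
  by (auto simp: unit_vec_def topspace_Euclidean_space)

lemma scaleR_eq_const_smult: "c *\<^sub>R X = (\<lambda>_. c) \<odot> X"
  by (simp add: fun_eq_iff)

locale smooth_vbundle = smooth_mfd M
  for M :: "'m::{t2_space,second_countable_topology} mfd" +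
  fixes E :: "('m, 'v::real_vector) vbundle"
  assumes is_vector_bundle: "vector_bundle M E"
begin

lemma fibre_subspace: "subspace (fibre E p)"
  using is_vector_bundle by (auto simp: vector_bundle_def)

lemma ex_triv: obtains U \<Phi> where "(U, \<Phi>) \<in> trivs E" "p \<in> U"
proof -
  have "p \<in> (\<Union>(U, \<Phi>)\<in>trivs E. U)"
    using is_vector_bundle by (auto simp: vector_bundle_def)
  then show ?thesis
    using that by auto
qed

lemma triv_open: "(U, \<Phi>) \<in> trivs E \<Longrightarrow> open U"
  using is_vector_bundle by (auto simp: vector_bundle_def)

lemma triv_linear: "(U, \<Phi>) \<in> trivs E \<Longrightarrow> p \<in> U \<Longrightarrow> linear_on_subspace (fibre E p) (\<Phi> p)"
  and triv_bij_betw: "(U, \<Phi>) \<in> trivs E \<Longrightarrow> p \<in> U \<Longrightarrow>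
    bij_betw (\<Phi> p) (fibre E p) (topspace (Euclidean_space (rank E)))"
  using is_vector_bundle by (auto simp: vector_bundle_def)

lemma local_frame_in_fibre:
  assumes "(U, \<Phi>) \<in> trivs E" "p \<in> U" "j < rank E"
  shows "local_frame E \<Phi> j p \<in> fibre E p"
  unfolding local_frame_def
  by (rule inv_into_into)
     (use bij_betw_imp_surj_on[OF triv_bij_betw[OF assms(1,2)]] unit_vec_in_Euclidean_space[OF assms(3)] in simp)

lemma triv_local_frame:
  assumes "(U, \<Phi>) \<in> trivs E" "p \<in> U" "j < rank E"
  shows "\<Phi> p (local_frame E \<Phi> j p) = unit_vec j"
  unfolding local_frame_def
  by (rule f_inv_into_f)
     (use bij_betw_imp_surj_on[OF triv_bij_betw[OF assms(1,2)]] unit_vec_in_Euclidean_space[OF assms(3)] in simp)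

lemma local_frame_expansion:
  assumes U: "(U, \<Phi>) \<in> trivs E" "p \<in> U" and x: "x \<in> fibre E p"
  shows "x = (\<Sum>j<rank E. \<Phi> p x j *\<^sub>R local_frame E \<Phi> j p)" (is "x = ?s")
proof -
  have s: "?s \<in> fibre E p"
    using local_frame_in_fibre[OF U] by (intro subspace_sum subspace_scale fibre_subspace) auto
  have "\<Phi> p ?s = (\<Sum>j<rank E. \<Phi> p x j *\<^sub>R \<Phi> p (local_frame E \<Phi> j p))"
    by (rule linear_on_subspace_sum[OF triv_linear[OF U] fibre_subspace])
       (use local_frame_in_fibre[OF U] in simp)
  also have "\<dots> = (\<Sum>j<rank E. \<Phi> p x j *\<^sub>R unit_vec j)"
    using triv_local_frame[OF U] by simp
  also have "\<dots> = \<Phi> p x"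
  proof
    fix i
    have "\<Phi> p x \<in> topspace (Euclidean_space (rank E))"
      using triv_bij_betw[OF U] x by (auto simp: bij_betw_def)
    then have "\<Phi> p x i = 0" if "i \<ge> rank E"
      using that by (auto simp: topspace_Euclidean_space)
    then show "(\<Sum>j<rank E. \<Phi> p x j *\<^sub>R unit_vec j) i = \<Phi> p x i"
      by (cases "i < rank E") (simp_all add: sum_fun_apply unit_vec_def if_distrib not_less cong: if_cong)
  qed
  finally show ?thesis
    using triv_bij_betw[OF U] s x by (auto simp: bij_betw_def inj_on_def)
qed

lemma transition_smooth:
  "(U, \<Phi>) \<in> trivs E \<Longrightarrow> (V, \<Psi>) \<in> trivs E \<Longrightarrow> i < rank E \<Longrightarrow> j < rank E \<Longrightarrow>
     smooth_fun_on M (U \<inter> V) (\<lambda>p. \<Psi> p (local_frame E \<Phi> j p) i)"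
  using is_vector_bundle unfolding vector_bundle_def by fast

lemma section_in_fibre: "X \<in> sections M E \<Longrightarrow> X p \<in> fibre E p"
  by (auto simp: sections_def)

lemma section_component_smooth:
  "X \<in> sections M E \<Longrightarrow> (U, \<Phi>) \<in> trivs E \<Longrightarrow> i < rank E \<Longrightarrow> smooth_fun_on M U (\<lambda>p. \<Phi> p (X p) i)"
  by (auto simp: sections_def)

lemma sections_add:
  assumes "X \<in> sections M E" "Y \<in> sections M E"
  shows "X + Y \<in> sections M E"
  unfolding sections_def
proof (safe, goal_cases)
  case (1 p)
  then show ?case
    using assms by (auto intro: subspace_add fibre_subspace section_in_fibre)
next
  case (2 U \<Phi> i)
  have eq: "\<Phi> p (X p) i + \<Phi> p (Y p) i = \<Phi> p ((X + Y) p) i" if "p \<in> U" for p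
    using triv_linear[OF 2(1) that] section_in_fibre assms by (simp add: linear_on_subspace_def)
  show ?case
    by (rule smooth_fun_on_cong[OF triv_open[OF 2(1)] smooth_fun_on_add[OF triv_open[OF 2(1)]
          section_component_smooth[OF assms(1) 2] section_component_smooth[OF assms(2) 2]] eq])
qed

lemma sections_smult:
  assumes "f \<in> Cinf M" "X \<in> sections M E"
  shows "f \<odot> X \<in> sections M E"
  unfolding sections_def
proof (safe, goal_cases)
  case (1 p)
  then show ?case
    using assms by (auto intro: subspace_scale fibre_subspace section_in_fibre)
next
  case (2 U \<Phi> i)
  have eq: "f p * \<Phi> p (X p) i = \<Phi> p ((f \<odot> X) p) i" if "p \<in> U" for p
    using triv_linear[OF 2(1) that] section_in_fibre assms by (simp add: linear_on_subspace_def)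
  show ?case
    by (rule smooth_fun_on_cong[OF triv_open[OF 2(1)] smooth_fun_on_mult[OF triv_open[OF 2(1)]
          Cinf_smooth_fun_on[OF assms(1) triv_open[OF 2(1)]] section_component_smooth[OF assms(2) 2]] eq])
qed

lemma sections_scaleR: "X \<in> sections M E \<Longrightarrow> c *\<^sub>R X \<in> sections M E"
  unfolding scaleR_eq_const_smult by (intro sections_smult Cinf_const)

lemma sections_0: "0 \<in> sections M E"
  unfolding sections_def
proof (safe, goal_cases)
  case (1 p)
  then show ?case
    by (simp add: subspace_0 fibre_subspace)
next
  case (2 U \<Phi> i)
  have "0 = \<Phi> p (0 p) i" if "p \<in> U" for p
    using linear_on_subspace_0[OF triv_linear[OF 2(1) that] fibre_subspace] by simp
  then show ?case
    by (rule smooth_fun_on_cong[OF triv_open[OF 2(1)] smooth_fun_on_const[OF triv_open[OF 2(1)]]])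
qed

lemma sections_diff: "X \<in> sections M E \<Longrightarrow> Y \<in> sections M E \<Longrightarrow> X - Y \<in> sections M E"
  using sections_add[of X "(-1) *\<^sub>R Y"] sections_scaleR[of Y "-1"] by simp

lemma sections_sum: "(\<And>i. i \<in> J \<Longrightarrow> X i \<in> sections M E) \<Longrightarrow> (\<Sum>i\<in>J. X i) \<in> sections M E"
  by (induction J rule: infinite_finite_induct) (auto intro: sections_0 sections_add)

text \<open>A local frame is extended to global sections by multiplying it with a cutoff; the arbitrary values that
  \<^const>\<open>local_frame\<close> has off \<open>U\<close> are multiplied by \<open>0\<close>.\<close>

lemma cutoff_local_frame_section:
  assumes U: "(U, \<Phi>) \<in> trivs E" and j: "j < rank E"
    and \<beta>: "\<beta> \<in> Cinf M" "closed K" "K \<subseteq> U" "\<And>q. q \<notin> K \<Longrightarrow> \<beta> q = 0"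
  shows "\<beta> \<odot> local_frame E \<Phi> j \<in> sections M E"
  unfolding sections_def
proof (safe, goal_cases)
  case (1 p)
  then show ?case
    using \<beta>(3,4) local_frame_in_fibre[OF U _ j, of p]
    by (cases "p \<in> K") (auto intro: subspace_scale subspace_0 fibre_subspace)
next
  case (2 V \<Psi> i)
  show ?case
  proof (rule smooth_fun_on_local[OF triv_open[OF 2(1)]])
    fix q assume q: "q \<in> V"
    show "\<exists>W. open W \<and> q \<in> W \<and>
        smooth_fun_on M W (\<lambda>p. \<Psi> p ((\<beta> \<odot> local_frame E \<Phi> j) p) i)"
    proof (cases "q \<in> U")
      case True
      have o: "open (U \<inter> V)" using triv_open U 2 by blast
      have eq: "\<beta> p * \<Psi> p (local_frame E \<Phi> j p) i = \<Psi> p ((\<beta> \<odot> local_frame E \<Phi> j) p) i"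
        if "p \<in> U \<inter> V" for p
        using triv_linear[OF 2(1), of p] local_frame_in_fibre[OF U _ j, of p] that
        by (simp add: linear_on_subspace_def)
      have "smooth_fun_on M (U \<inter> V) (\<lambda>p. \<Psi> p ((\<beta> \<odot> local_frame E \<Phi> j) p) i)"
        by (rule smooth_fun_on_cong[OF o smooth_fun_on_mult[OF o
              Cinf_smooth_fun_on[OF \<beta>(1) o] transition_smooth[OF U 2 j]] eq])
      then show ?thesis using True q o by blast
    next
      case False
      have o: "open (V \<inter> - K)" using triv_open[OF 2(1)] \<beta>(2) by auto
      have eq: "0 = \<Psi> p ((\<beta> \<odot> local_frame E \<Phi> j) p) i" if "p \<in> V \<inter> - K" for p
        using linear_on_subspace_0[OF triv_linear[OF 2(1)] fibre_subspace] \<beta>(4) that by simp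
      have "smooth_fun_on M (V \<inter> - K) (\<lambda>p. \<Psi> p ((\<beta> \<odot> local_frame E \<Phi> j) p) i)"
        by (rule smooth_fun_on_cong[OF o smooth_fun_on_const[OF o] eq])
      then show ?thesis using False q o \<beta>(3) by blast
    qed
  qed
qed

lemma ex_section_through:
  assumes x: "x \<in> fibre E p"
  obtains X where "X \<in> sections M E" "X p = x"
proof -
  obtain U \<Phi> where U: "(U, \<Phi>) \<in> trivs E" "p \<in> U" by (rule ex_triv)
  obtain \<beta> N K where \<beta>: "\<beta> \<in> Cinf M" "open N" "p \<in> N" "closed K" "K \<subseteq> U"
    "\<And>q. q \<in> N \<Longrightarrow> \<beta> q = 1" "\<And>q. q \<notin> K \<Longrightarrow> \<beta> q = 0"
    using ex_cutoff[OF triv_open[OF U(1)] U(2)] by blast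
  show ?thesis
  proof (rule that)
    show "(\<Sum>j<rank E. \<Phi> p x j *\<^sub>R (\<beta> \<odot> local_frame E \<Phi> j)) \<in> sections M E"
      using \<beta> by (intro sections_sum sections_scaleR cutoff_local_frame_section[OF U(1)]) auto
    show "(\<Sum>j<rank E. \<Phi> p x j *\<^sub>R (\<beta> \<odot> local_frame E \<Phi> j)) p = x"
      using local_frame_expansion[OF U x] \<beta>(3,6) by (simp add: sum_fun_apply)
  qed
qed

lemma fibre_rank_0:
  assumes "rank E = 0" "x \<in> fibre E p"
  shows "x = 0"
proof -
  obtain U \<Phi> where U: "(U, \<Phi>) \<in> trivs E" "p \<in> U" by (rule ex_triv)
  then show ?thesis
    using local_frame_expansion[OF U assms(2)] assms(1) by simp
qed

lemma dual_section_linear: "\<zeta> \<in> sections M (dual_bundle E) \<Longrightarrow> linear_on_subspace (fibre E p) (\<zeta> p)"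
  by (simp add: sections_dual_bundle_iff)

lemma dual_section_component_smooth:
  "\<zeta> \<in> sections M (dual_bundle E) \<Longrightarrow> (U, \<Phi>) \<in> trivs E \<Longrightarrow> j < rank E \<Longrightarrow>
     smooth_fun_on M U (\<lambda>p. \<zeta> p (local_frame E \<Phi> j p))"
  by (auto simp: sections_dual_bundle_iff)

lemma pairing_add:
  assumes "X \<in> sections M E" "Y \<in> sections M E" "\<zeta> \<in> sections M (dual_bundle E)"
  shows "\<langle>X + Y, \<zeta>\<rangle> = \<langle>X, \<zeta>\<rangle> + \<langle>Y, \<zeta>\<rangle>"
  using assms section_in_fibre dual_section_linear by (simp add: fun_eq_iff linear_on_subspace_def)

lemma pairing_smult:
  assumes "X \<in> sections M E" "\<zeta> \<in> sections M (dual_bundle E)"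
  shows "\<langle>f \<odot> X, \<zeta>\<rangle> = f * \<langle>X, \<zeta>\<rangle>"
  using assms section_in_fibre dual_section_linear by (simp add: fun_eq_iff linear_on_subspace_def)

lemma pairing_0:
  assumes "\<zeta> \<in> sections M (dual_bundle E)"
  shows "\<langle>0, \<zeta>\<rangle> = 0"
  using linear_on_subspace_0[OF dual_section_linear[OF assms] fibre_subspace] by (simp add: fun_eq_iff)

lemma pairing_diff:
  assumes "X \<in> sections M E" "Y \<in> sections M E" "\<zeta> \<in> sections M (dual_bundle E)"
  shows "\<langle>X - Y, \<zeta>\<rangle> = \<langle>X, \<zeta>\<rangle> - \<langle>Y, \<zeta>\<rangle>"
  using pairing_add[OF sections_diff[OF assms(1,2)] assms(2,3)] by (simp add: algebra_simps)

lemma pairing_smooth: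
  assumes "X \<in> sections M E" "\<zeta> \<in> sections M (dual_bundle E)"
  shows "\<langle>X, \<zeta>\<rangle> \<in> Cinf M"
proof (rule CinfI_local)
  fix q
  obtain U \<Phi> where U: "(U, \<Phi>) \<in> trivs E" "q \<in> U" by (rule ex_triv)
  note o = triv_open[OF U(1)]
  have eq: "(\<Sum>j<rank E. \<Phi> p (X p) j * \<zeta> p (local_frame E \<Phi> j p)) = \<langle>X, \<zeta>\<rangle> p" if p: "p \<in> U" for p
  proof -
    have "\<zeta> p (X p) = \<zeta> p (\<Sum>j<rank E. \<Phi> p (X p) j *\<^sub>R local_frame E \<Phi> j p)"
      using local_frame_expansion[OF U(1) p section_in_fibre[OF assms(1)]] by simp
    also have "\<dots> = (\<Sum>j<rank E. \<Phi> p (X p) j *\<^sub>R \<zeta> p (local_frame E \<Phi> j p))"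
      by (rule linear_on_subspace_sum[OF dual_section_linear[OF assms(2)] fibre_subspace])
         (use local_frame_in_fibre[OF U(1) p] in simp)
    finally show ?thesis by simp
  qed
  have "smooth_fun_on M U (\<lambda>p. \<Sum>j<rank E. \<Phi> p (X p) j * \<zeta> p (local_frame E \<Phi> j p))"
    by (intro smooth_fun_on_sum[OF o] smooth_fun_on_mult[OF o]
        section_component_smooth[OF assms(1) U(1)] dual_section_component_smooth[OF assms(2) U(1)]) auto
  then have "smooth_fun_on M U \<langle>X, \<zeta>\<rangle>"
    by (rule smooth_fun_on_cong[OF o _ eq])
  then show "\<exists>W. open W \<and> q \<in> W \<and> smooth_fun_on M W \<langle>X, \<zeta>\<rangle>"
    using U(2) o by blast
qed

text \<open>There is a global section through every vector, so the pairings determine a dual section in each fibre.\<close>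

lemma dual_section_eqI:
  assumes "\<eta> \<in> sections M (dual_bundle E)" "\<zeta> \<in> sections M (dual_bundle E)"
    and "\<And>X. X \<in> sections M E \<Longrightarrow> \<langle>X, \<eta>\<rangle> = \<langle>X, \<zeta>\<rangle>"
  shows "\<eta> = \<zeta>"
proof (intro ext)
  fix p x
  show "\<eta> p x = \<zeta> p x"
  proof (cases "x \<in> fibre E p")
    case True
    then obtain X where "X \<in> sections M E" "X p = x" by (rule ex_section_through)
    then show ?thesis using assms(3)[of X] by (auto simp: fun_eq_iff)
  next
    case False
    then show ?thesis using assms(1,2) by (simp add: sections_dual_bundle_iff)
  qed
qed

text \<open>With a cutoff \<open>\<beta>\<close> at \<open>p\<close>, the section \<open>(\<beta> * \<beta>) \<odot> X\<close> is a combination of the global sections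
  \<open>\<beta> \<odot> local_frame E \<Phi> j\<close>, with coefficients that are smooth and vanish at \<open>p\<close>. One factor \<open>\<beta>\<close>
  makes the coefficients global, the other one the frame.\<close>

lemma Cinf_linear_local:
  fixes T :: "('m \<Rightarrow> 'v) \<Rightarrow> 'm \<Rightarrow> real"
  assumes add: "\<And>X Y. X \<in> sections M E \<Longrightarrow> Y \<in> sections M E \<Longrightarrow> T (X + Y) = T X + T Y"
    and smult: "\<And>f X. f \<in> Cinf M \<Longrightarrow> X \<in> sections M E \<Longrightarrow> T (f \<odot> X) = f * T X"
    and X: "X \<in> sections M E" and X0: "X p = 0"
  shows "T X p = 0"
proof -
  obtain U \<Phi> where U: "(U, \<Phi>) \<in> trivs E" "p \<in> U" by (rule ex_triv)
  obtain \<beta> N K where \<beta>: "\<beta> \<in> Cinf M" "open N" "p \<in> N" "closed K" "K \<subseteq> U"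
    "\<And>q. q \<in> N \<Longrightarrow> \<beta> q = 1" "\<And>q. q \<notin> K \<Longrightarrow> \<beta> q = 0"
    using ex_cutoff[OF triv_open[OF U(1)] U(2)] by blast
  define c where "c j q = \<beta> q * \<Phi> q (X q) j" for j q
  define e where "e j = \<beta> \<odot> local_frame E \<Phi> j" for j
  have c: "c j \<in> Cinf M" if "j < rank E" for j
    using cutoff_mult_Cinf[OF \<beta>(1,4,5,7) triv_open[OF U(1)] section_component_smooth[OF X U(1) that]]
    by (simp add: c_def[abs_def])
  have e: "e j \<in> sections M E" if "j < rank E" for j
    unfolding e_def using \<beta> by (intro cutoff_local_frame_section[OF U(1) that]) auto
  have T0: "T 0 = 0"
    using add[OF sections_0 sections_0] by simp
  have "T (\<Sum>j\<in>J. c j \<odot> e j) = (\<Sum>j\<in>J. c j * T (e j))" if "J \<subseteq> {..<rank E}" for J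
    using finite_subset[OF that finite_lessThan] that
  proof (induction J rule: finite_induct)
    case (insert j J)
    have j: "c j \<in> Cinf M" "e j \<in> sections M E"
      using insert c e by auto
    have "(\<Sum>j\<in>J. c j \<odot> e j) \<in> sections M E"
      using insert c e by (auto intro!: sections_sum sections_smult)
    then have "T (c j \<odot> e j + (\<Sum>j\<in>J. c j \<odot> e j)) = c j * T (e j) + (\<Sum>j\<in>J. c j * T (e j))"
      using add[OF sections_smult[OF j]] smult[OF j] insert.IH insert.prems by (simp del: fun_smult_apply times_fun_apply)
    then show ?case using insert.hyps by (simp del: fun_smult_apply times_fun_apply plus_fun_apply)
  qed (simp add: T0)
  then have sum: "T (\<Sum>j<rank E. c j \<odot> e j) = (\<Sum>j<rank E. c j * T (e j))" by blast
  have "(\<beta> * \<beta>) \<odot> X = (\<Sum>j<rank E. c j \<odot> e j)"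
  proof
    fix q
    show "((\<beta> * \<beta>) \<odot> X) q = (\<Sum>j<rank E. c j \<odot> e j) q"
    proof (cases "q \<in> U")
      case True
      have "((\<beta> * \<beta>) \<odot> X) q = (\<beta> q * \<beta> q) *\<^sub>R (\<Sum>j<rank E. \<Phi> q (X q) j *\<^sub>R local_frame E \<Phi> j q)"
        using local_frame_expansion[OF U(1) True section_in_fibre[OF X]] by simp
      also have "\<dots> = (\<Sum>j<rank E. c j \<odot> e j) q"
        by (simp add: sum_fun_apply c_def e_def scaleR_sum_right mult_ac)
      finally show ?thesis .
    next
      case False
      then have "\<beta> q = 0" using \<beta> by blast
      then show ?thesis by (simp add: sum_fun_apply c_def)
    qed
  qed
  then have "(\<beta> * \<beta>) * T X = (\<Sum>j<rank E. c j * T (e j))"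
    using sum smult[OF Cinf_mult[OF \<beta>(1) \<beta>(1)] X] by simp
  then have "(\<beta> * \<beta> * T X) p = (\<Sum>j<rank E. c j p * T (e j) p)"
    by (simp add: sum_fun_apply)
  moreover have "c j p = 0" if "j < rank E" for j
    using linear_on_subspace_0[OF triv_linear[OF U] fibre_subspace] X0 by (simp add: c_def)
  ultimately show ?thesis
    using \<beta>(3,6) by simp
qed

text \<open>By \<open>Cinf_linear_local\<close> the value of \<open>T X\<close> at \<open>p\<close> depends only on \<open>X p\<close>, which defines a functional on
  each fibre. Near a given point its components are the functions \<open>T (\<beta> \<odot> local_frame E \<Phi> j)\<close> with \<open>\<beta>\<close> a
  cutoff there, so they are smooth.\<close>

lemma Cinf_linear_is_dual_section:
  fixes T :: "('m \<Rightarrow> 'v) \<Rightarrow> 'm \<Rightarrow> real"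
  assumes add: "\<And>X Y. X \<in> sections M E \<Longrightarrow> Y \<in> sections M E \<Longrightarrow> T (X + Y) = T X + T Y"
    and smult: "\<And>f X. f \<in> Cinf M \<Longrightarrow> X \<in> sections M E \<Longrightarrow> T (f \<odot> X) = f * T X"
    and smooth: "\<And>X. X \<in> sections M E \<Longrightarrow> T X \<in> Cinf M"
  obtains \<eta> where "\<eta> \<in> sections M (dual_bundle E)" "\<And>X. X \<in> sections M E \<Longrightarrow> \<langle>X, \<eta>\<rangle> = T X"
proof -
  have "\<exists>s. \<forall>p x. x \<in> fibre E p \<longrightarrow> s p x \<in> sections M E \<and> s p x p = x"
    by (intro choice allI) (meson ex_section_through)
  then obtain s where s: "\<And>p x. x \<in> fibre E p \<Longrightarrow> s p x \<in> sections M E"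
    "\<And>p x. x \<in> fibre E p \<Longrightarrow> s p x p = x" by blast
  define \<eta> where "\<eta> p x = (if x \<in> fibre E p then T (s p x) p else 0)" for p x
  have \<eta>_eq: "\<eta> p (X p) = T X p" if X: "X \<in> sections M E" for X p
  proof -
    have x: "X p \<in> fibre E p" by (rule section_in_fibre[OF X])
    have "T (X - s p (X p)) p = 0"
      using X s[OF x] by (intro Cinf_linear_local[of T] add smult sections_diff) auto
    moreover have "T X = T (X - s p (X p)) + T (s p (X p))"
      using add[OF sections_diff[OF X s(1)[OF x]] s(1)[OF x]] by simp
    ultimately show ?thesis using x by (simp add: \<eta>_def)
  qed
  have "\<eta> \<in> sections M (dual_bundle E)"
    unfolding sections_dual_bundle_iff
  proof (intro conjI allI impI ballI, goal_cases)
    case (1 p)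
    show ?case
      unfolding linear_on_subspace_def
    proof (intro conjI ballI allI)
      fix x y assume xy: "x \<in> fibre E p" "y \<in> fibre E p"
      show "\<eta> p (x + y) = \<eta> p x + \<eta> p y"
        using \<eta>_eq[of "s p x + s p y" p] \<eta>_eq[of "s p x" p] \<eta>_eq[of "s p y" p] s[OF xy(1)] s[OF xy(2)]
        by (simp add: add sections_add)
    next
      fix c x assume x: "x \<in> fibre E p"
      show "\<eta> p (c *\<^sub>R x) = c *\<^sub>R \<eta> p x"
        using \<eta>_eq[of "(\<lambda>_. c) \<odot> s p x" p] \<eta>_eq[of "s p x" p] s[OF x]
        by (simp add: smult sections_smult Cinf_const)
    qed
  next
    case (2 p x)
    then show ?case by (simp add: \<eta>_def)
  next
    case (3 a)
    obtain U \<Phi> where a: "a = (U, \<Phi>)" "(U, \<Phi>) \<in> trivs E" using 3 by (cases a) auto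
    note U = a(2)
    have "smooth_fun_on M U (\<lambda>p. \<eta> p (local_frame E \<Phi> j p))" if j: "j < rank E" for j
    proof (rule smooth_fun_on_local[OF triv_open[OF U]])
      fix q assume q: "q \<in> U"
      obtain \<beta> N K where \<beta>: "\<beta> \<in> Cinf M" "open N" "q \<in> N" "closed K" "K \<subseteq> U"
        "\<And>q. q \<in> N \<Longrightarrow> \<beta> q = 1" "\<And>q. q \<notin> K \<Longrightarrow> \<beta> q = 0"
        using ex_cutoff[OF triv_open[OF U] q] by blast
      have e: "\<beta> \<odot> local_frame E \<Phi> j \<in> sections M E"
        using \<beta> by (intro cutoff_local_frame_section[OF U j]) auto
      have eq: "T (\<beta> \<odot> local_frame E \<Phi> j) p = \<eta> p (local_frame E \<Phi> j p)" if "p \<in> N" for p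
        using \<eta>_eq[OF e, of p] \<beta>(6)[OF that] by simp
      have "smooth_fun_on M N (\<lambda>p. \<eta> p (local_frame E \<Phi> j p))"
        by (rule smooth_fun_on_cong[OF \<beta>(2) Cinf_smooth_fun_on[OF smooth[OF e] \<beta>(2)] eq])
      then show "\<exists>W. open W \<and> q \<in> W \<and> smooth_fun_on M W (\<lambda>p. \<eta> p (local_frame E \<Phi> j p))"
        using \<beta>(2,3) by blast
    qed
    then show ?case using a by simp
  qed
  then show ?thesis
    using that[of \<eta>] \<eta>_eq by (simp add: fun_eq_iff)
qed

end

section \<open>Differential operators and their duals\<close>

lemma subspace_tangent_space: "subspace (tangent_space M p)"
  by (auto simp: subspace_def tangent_space_def algebra_simps)

context smooth_mfd
begin

lemma vector_field_tangent: "V \<in> sections M (tangent_bundle M) \<Longrightarrow> V p \<in> tangent_space M p"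
  by (simp add: sections_def tangent_bundle_def)

lemma vf_apply_add:
  assumes "V \<in> sections M (tangent_bundle M)" "f \<in> Cinf M" "g \<in> Cinf M"
  shows "vf_apply V (f + g) = vf_apply V f + vf_apply V g"
proof
  fix p
  show "vf_apply V (f + g) p = (vf_apply V f + vf_apply V g) p"
    using vector_field_tangent[OF assms(1), of p] Cinf_smooth_near[OF assms(2), of p]
      Cinf_smooth_near[OF assms(3), of p]
    unfolding tangent_space_def vf_apply_apply plus_fun_apply by blast
qed

lemma vf_apply_mult:
  assumes "V \<in> sections M (tangent_bundle M)" "f \<in> Cinf M" "g \<in> Cinf M"
  shows "vf_apply V (f * g) = f * vf_apply V g + g * vf_apply V f"
proof
  fix p
  show "vf_apply V (f * g) p = (f * vf_apply V g + g * vf_apply V f) p"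
    using vector_field_tangent[OF assms(1), of p] Cinf_smooth_near[OF assms(2), of p]
      Cinf_smooth_near[OF assms(3), of p]
    unfolding tangent_space_def vf_apply_apply plus_fun_apply times_fun_apply by blast
qed

lemma vf_apply_0: "V \<in> sections M (tangent_bundle M) \<Longrightarrow> vf_apply V 0 = 0"
  using vf_apply_add[of V 0 0] Cinf_const[of 0] by (simp add: zero_fun_def[symmetric])

lemma vf_apply_sum:
  assumes "V \<in> sections M (tangent_bundle M)" "\<And>i. i \<in> J \<Longrightarrow> f i \<in> Cinf M"
  shows "vf_apply V (\<Sum>i\<in>J. f i) = (\<Sum>i\<in>J. vf_apply V (f i))"
  using assms(2) by (induction J rule: infinite_finite_induct)
    (simp_all add: vf_apply_0 vf_apply_add assms(1) Cinf_sum del: vf_apply_apply)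

end

context smooth_vbundle
begin

lemma differential_operator_section:
  "differential_operator M E D D' \<Longrightarrow> X \<in> sections M E \<Longrightarrow> D X \<in> sections M E"
  and differential_operator_symbol:
  "differential_operator M E D D' \<Longrightarrow> D' \<in> sections M (tangent_bundle M)"
  and differential_operator_add:
  "differential_operator M E D D' \<Longrightarrow> X \<in> sections M E \<Longrightarrow> Y \<in> sections M E \<Longrightarrow> D (X + Y) = D X + D Y"
  and differential_operator_scaleR:
  "differential_operator M E D D' \<Longrightarrow> X \<in> sections M E \<Longrightarrow> D (c *\<^sub>R X) = c *\<^sub>R D X"
  and differential_operator_smult:
  "differential_operator M E D D' \<Longrightarrow> X \<in> sections M E \<Longrightarrow> f \<in> Cinf M \<Longrightarrow>
     D (f \<odot> X) = f \<odot> D X + vf_apply D' f \<odot> X"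
  by (auto simp: differential_operator_def linear_on_subspace_def)

lemma differential_operator_diff:
  assumes "differential_operator M E D D'" "X \<in> sections M E" "Y \<in> sections M E"
  shows "D (X - Y) = D X - D Y"
  using differential_operator_add[OF assms(1) sections_diff[OF assms(2,3)] assms(3)]
  by (simp add: algebra_simps)

lemma differential_operator_sum:
  assumes "differential_operator M E D D'" "\<And>i. i \<in> J \<Longrightarrow> X i \<in> sections M E"
  shows "D (\<Sum>i\<in>J. X i) = (\<Sum>i\<in>J. D (X i))"
proof -
  have "D 0 = 0"
    using differential_operator_diff[OF assms(1) sections_0 sections_0] by simp
  then show ?thesis
    using assms(2) by (induction J rule: infinite_finite_induct)
      (simp_all add: differential_operator_add[OF assms(1)] sections_sum)
qed

text \<open>If \<open>Y\<close> is a section equal to a frame vector near \<open>p\<close>, then \<open>vf_apply D' f\<close> is near \<open>p\<close> a component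
  of the smooth section \<open>D (f \<odot> Y) - f \<odot> D Y\<close>. This spares the expression of vector fields in
  coordinates, for which derivations would have to be shown to be combinations of partial derivatives.\<close>

lemma symbol_smooth:
  assumes D: "differential_operator M E D D'" and r: "0 < rank E" and f: "f \<in> Cinf M"
  shows "vf_apply D' f \<in> Cinf M"
proof (rule CinfI_local)
  fix q
  obtain U \<Phi> where U: "(U, \<Phi>) \<in> trivs E" "q \<in> U" by (rule ex_triv)
  obtain \<beta> N K where \<beta>: "\<beta> \<in> Cinf M" "open N" "q \<in> N" "closed K" "K \<subseteq> U"
    "\<And>q. q \<in> N \<Longrightarrow> \<beta> q = 1" "\<And>q. q \<notin> K \<Longrightarrow> \<beta> q = 0"
    using ex_cutoff[OF triv_open[OF U(1)] U(2)] by blast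
  have NU: "N \<subseteq> U" using \<beta> by (metis in_mono subsetI zero_neq_one)
  define Y where "Y = \<beta> \<odot> local_frame E \<Phi> 0"
  have Y: "Y \<in> sections M E"
    unfolding Y_def using \<beta> by (intro cutoff_local_frame_section[OF U(1) r]) auto
  have "D (f \<odot> Y) - f \<odot> D Y \<in> sections M E"
    by (intro sections_diff differential_operator_section[OF D] sections_smult f Y)
  then have Z: "vf_apply D' f \<odot> Y \<in> sections M E"
    by (simp add: differential_operator_smult[OF D Y f])
  have eq: "\<Phi> p ((vf_apply D' f \<odot> Y) p) 0 = vf_apply D' f p" if p: "p \<in> N" for p
  proof -
    have "(vf_apply D' f \<odot> Y) p = D' p f *\<^sub>R local_frame E \<Phi> 0 p"
      by (simp add: Y_def \<beta>(6)[OF p])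
    moreover have "\<Phi> p (D' p f *\<^sub>R local_frame E \<Phi> 0 p) = D' p f *\<^sub>R \<Phi> p (local_frame E \<Phi> 0 p)"
      using triv_linear[OF U(1)] local_frame_in_fibre[OF U(1) _ r] p NU
      by (auto simp: linear_on_subspace_def)
    ultimately show ?thesis
      using triv_local_frame[OF U(1) _ r, of p] p NU by (auto simp: unit_vec_def)
  qed
  have "smooth_fun_on M N (\<lambda>p. \<Phi> p ((vf_apply D' f \<odot> Y) p) 0)"
    using smooth_fun_on_subset[OF triv_open[OF U(1)] \<beta>(2) NU section_component_smooth[OF Z U(1) r]] .
  then have "smooth_fun_on M N (vf_apply D' f)"
    by (rule smooth_fun_on_cong[OF \<beta>(2) _ eq])
  then show "\<exists>W. open W \<and> q \<in> W \<and> smooth_fun_on M W (vf_apply D' f)"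
    using \<beta> by blast
qed

lemma pairing_rank_0:
  assumes "rank E = 0" "X \<in> sections M E" "\<zeta> \<in> sections M (dual_bundle E)"
  shows "\<langle>X, \<zeta>\<rangle> = 0"
proof -
  have "X = 0"
    using fibre_rank_0[OF assms(1) section_in_fibre[OF assms(2)]] by (simp add: fun_eq_iff)
  then show ?thesis by (simp add: pairing_0[OF assms(3)])
qed

text \<open>The right hand side is \<open>C\<^sup>\<infinity>\<close>-linear in \<open>X\<close>, as the two derivatives of a function factor cancel. Hence it is the
  pairing with a dual section, and only with one, so that the definite description in
  \<^const>\<open>dual_operator\<close> denotes it.\<close>

lemma dual_operator_pairing:
  assumes D: "differential_operator M E D D'" and \<zeta>: "\<zeta> \<in> sections M (dual_bundle E)"
    and X: "X \<in> sections M E"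
  shows "\<langle>X, dual_operator M E D D' \<zeta>\<rangle> = vf_apply D' \<langle>X, \<zeta>\<rangle> - \<langle>D X, \<zeta>\<rangle>"
proof -
  define T where "T X = vf_apply D' \<langle>X, \<zeta>\<rangle> - \<langle>D X, \<zeta>\<rangle>" for X
  note D_sec = differential_operator_section[OF D] and D_sym = differential_operator_symbol[OF D]
  have "T (X + Y) = T X + T Y" if "X \<in> sections M E" "Y \<in> sections M E" for X Y
    using that \<zeta>
    by (simp add: T_def differential_operator_add[OF D] pairing_add D_sec
        vf_apply_add[OF D_sym] pairing_smooth)
  moreover have "T (f \<odot> X) = f * T X" if f: "f \<in> Cinf M" and X: "X \<in> sections M E" for f X
  proof -
    have "f \<odot> D X \<in> sections M E" using f X by (intro sections_smult D_sec)
    moreover have "vf_apply D' f \<odot> X \<in> sections M E"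
      using sections_diff[OF D_sec[OF sections_smult[OF f X]] \<open>f \<odot> D X \<in> sections M E\<close>]
      by (simp add: differential_operator_smult[OF D X f])
    ultimately have "\<langle>D (f \<odot> X), \<zeta>\<rangle> = f * \<langle>D X, \<zeta>\<rangle> + vf_apply D' f * \<langle>X, \<zeta>\<rangle>"
      using X \<zeta> by (simp add: differential_operator_smult[OF D X f] pairing_add
          pairing_smult D_sec)
    moreover have "vf_apply D' \<langle>f \<odot> X, \<zeta>\<rangle> = f * vf_apply D' \<langle>X, \<zeta>\<rangle> + \<langle>X, \<zeta>\<rangle> * vf_apply D' f"
      using X \<zeta> f by (simp add: pairing_smult vf_apply_mult[OF D_sym] pairing_smooth)
    ultimately show ?thesis
      by (simp add: T_def algebra_simps)
  qed
  moreover have "T X \<in> Cinf M" if X: "X \<in> sections M E" for X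
  proof (cases "rank E = 0")
    \<comment> \<open>On a bundle of rank \<open>0\<close> nothing relates the symbol to \<open>D\<close>, but then all pairings vanish.\<close>
    case True
    then have "T X = 0"
      using X \<zeta> D_sec by (simp add: T_def pairing_rank_0 vf_apply_0[OF D_sym])
    then show ?thesis
      using Cinf_const[of 0] by (simp add: zero_fun_def)
  next
    case False
    then show ?thesis
      unfolding T_def using X \<zeta>
      by (intro Cinf_diff symbol_smooth[OF D] pairing_smooth D_sec) auto
  qed
  ultimately obtain \<eta> where \<eta>: "\<eta> \<in> sections M (dual_bundle E)"
    "\<And>X. X \<in> sections M E \<Longrightarrow> \<langle>X, \<eta>\<rangle> = T X"
    using Cinf_linear_is_dual_section[of T] by blast
  have "dual_operator M E D D' \<zeta> = \<eta>"
    unfolding dual_operator_def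
  proof (rule the_equality, goal_cases)
    case 1
    show ?case using \<eta> by (simp add: T_def)
  next
    case (2 \<theta>)
    then show ?case
      using \<eta> by (intro dual_section_eqI) (auto simp: T_def)
  qed
  then show ?thesis using \<eta>(2)[OF X] by (simp add: T_def)
qed

end

section \<open>The Lie algebroid of a family of operators and dual sections\<close>

text \<open>Expanding \<open>\<nabla>\<^sub>X \<nabla>\<^sub>Y Z - \<nabla>\<^sub>Y \<nabla>\<^sub>X Z\<close> at a point, with \<open>x i\<close>, \<open>y i\<close> the components of \<open>X\<close> and \<open>Y\<close>, with
  \<open>dy i j\<close> the derivative of \<open>y j\<close> along the \<open>i\<close>-th symbol and with \<open>a2 i j\<close> the second order terms. The
  second order terms enter only through their antisymmetric part. The same expansion computes
  the commutator of two anchored vector fields on a function.\<close>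

lemma double_commutator_sum:
  fixes a1 :: "'i \<Rightarrow> 'w::real_vector"
  assumes I: "finite I"
    and comm: "\<And>i j. i \<in> I \<Longrightarrow> j \<in> I \<Longrightarrow> a2 i j - a2 j i = (\<Sum>k\<in>I. f i j k *\<^sub>R a1 k)"
  shows "(\<Sum>i\<in>I. x i *\<^sub>R (\<Sum>j\<in>I. y j *\<^sub>R a2 i j + dy i j *\<^sub>R a1 j)) -
         (\<Sum>i\<in>I. y i *\<^sub>R (\<Sum>j\<in>I. x j *\<^sub>R a2 i j + dx i j *\<^sub>R a1 j)) =
         (\<Sum>k\<in>I. ((\<Sum>i\<in>I. x i * dy i k - y i * dx i k) + (\<Sum>i\<in>I. \<Sum>j\<in>I. f i j k * x i * y j)) *\<^sub>R a1 k)"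
proof -
  have swap: "(\<Sum>i\<in>I. \<Sum>j\<in>I. (y i * x j) *\<^sub>R a2 i j) = (\<Sum>i\<in>I. \<Sum>j\<in>I. (x i * y j) *\<^sub>R a2 j i)"
    by (subst sum.swap) (simp add: mult.commute)
  have "(\<Sum>i\<in>I. \<Sum>j\<in>I. (x i * y j) *\<^sub>R a2 i j) - (\<Sum>i\<in>I. \<Sum>j\<in>I. (y i * x j) *\<^sub>R a2 i j) =
      (\<Sum>i\<in>I. \<Sum>j\<in>I. (x i * y j) *\<^sub>R (a2 i j - a2 j i))"
    unfolding swap by (simp add: sum_subtractf scaleR_diff_right)
  also have "\<dots> = (\<Sum>i\<in>I. \<Sum>j\<in>I. \<Sum>k\<in>I. (f i j k * x i * y j) *\<^sub>R a1 k)"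
    by (intro sum.cong refl) (simp add: comm scaleR_sum_right mult_ac)
  also have "\<dots> = (\<Sum>i\<in>I. \<Sum>k\<in>I. \<Sum>j\<in>I. (f i j k * x i * y j) *\<^sub>R a1 k)"
    by (intro sum.cong refl sum.swap)
  also have "\<dots> = (\<Sum>k\<in>I. \<Sum>i\<in>I. \<Sum>j\<in>I. (f i j k * x i * y j) *\<^sub>R a1 k)"
    by (rule sum.swap)
  finally have second: "(\<Sum>i\<in>I. \<Sum>j\<in>I. (x i * y j) *\<^sub>R a2 i j) - (\<Sum>i\<in>I. \<Sum>j\<in>I. (y i * x j) *\<^sub>R a2 i j) =
      (\<Sum>k\<in>I. (\<Sum>i\<in>I. \<Sum>j\<in>I. f i j k * x i * y j) *\<^sub>R a1 k)"
    by (simp add: scaleR_sum_left)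
  have first: "(\<Sum>i\<in>I. \<Sum>j\<in>I. (x i * dy i j) *\<^sub>R a1 j) - (\<Sum>i\<in>I. \<Sum>j\<in>I. (y i * dx i j) *\<^sub>R a1 j) =
      (\<Sum>k\<in>I. (\<Sum>i\<in>I. x i * dy i k - y i * dx i k) *\<^sub>R a1 k)"
  proof -
    have "(\<Sum>i\<in>I. \<Sum>j\<in>I. c i j *\<^sub>R a1 j) = (\<Sum>j\<in>I. (\<Sum>i\<in>I. c i j) *\<^sub>R a1 j)" for c
      by (subst sum.swap) (simp add: scaleR_sum_left)
    then show ?thesis
      by (simp add: sum_subtractf scaleR_diff_left)
  qed
  show ?thesis
    unfolding scaleR_add_left sum.distrib first[symmetric] second[symmetric]
    by (simp add: scaleR_sum_right scaleR_add_right sum.distrib algebra_simps)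
qed

locale operator_family = smooth_vbundle M A
  for M :: "'m::{t2_space,second_countable_topology} mfd"
    and A :: "('m, 'v::real_vector) vbundle" +
  fixes I :: "'i set"
    and D :: "'i \<Rightarrow> ('m \<Rightarrow> 'v) \<Rightarrow> 'm \<Rightarrow> 'v"
    and D' :: "'i \<Rightarrow> 'm \<Rightarrow> ('m \<Rightarrow> real) \<Rightarrow> real"
    and \<xi> :: "'i \<Rightarrow> 'm \<Rightarrow> 'v \<Rightarrow> real"
    and f g :: "'i \<Rightarrow> 'i \<Rightarrow> 'i \<Rightarrow> 'm \<Rightarrow> real"
  assumes I: "finite I"
    and D: "\<And>i. i \<in> I \<Longrightarrow> differential_operator M A (D i) (D' i)"
    and D_comm: "\<And>i j Y. i \<in> I \<Longrightarrow> j \<in> I \<Longrightarrow> Y \<in> sections M A \<Longrightarrow>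
           D i (D j Y) - D j (D i Y) = (\<Sum>k\<in>I. f i j k \<odot> D k Y)"
    and xi: "\<And>i. i \<in> I \<Longrightarrow> \<xi> i \<in> sections M (dual_bundle A)"
    and dual: "\<And>i j. i \<in> I \<Longrightarrow> j \<in> I \<Longrightarrow>
           dual_operator M A (D i) (D' i) (\<xi> j) = (\<Sum>k\<in>I. g i k j \<odot> \<xi> k)"
    and f_eq: "\<And>i j k. i \<in> I \<Longrightarrow> j \<in> I \<Longrightarrow> k \<in> I \<Longrightarrow> f i j k = g j i k - g i j k"
begin

abbreviation "nabla \<equiv> dxi_nabla I D \<xi>"
abbreviation "bracket \<equiv> dxi_bracket I D \<xi>"
abbreviation "anchor \<equiv> dxi_anchor I D' \<xi>"

lemma D_section: "i \<in> I \<Longrightarrow> X \<in> sections M A \<Longrightarrow> D i X \<in> sections M A"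
  using differential_operator_section[OF D] .

lemma D'_vector_field: "i \<in> I \<Longrightarrow> D' i \<in> sections M (tangent_bundle M)"
  using differential_operator_symbol[OF D] .

lemma component_smooth: "i \<in> I \<Longrightarrow> X \<in> sections M A \<Longrightarrow> \<langle>X, \<xi> i\<rangle> \<in> Cinf M"
  by (rule pairing_smooth[OF _ xi])

lemma nabla_apply: "nabla X Y p = (\<Sum>i\<in>I. \<xi> i p (X p) *\<^sub>R D i Y p)"
  by (simp add: dxi_nabla_def sum_fun_apply)

lemma nabla_section: "X \<in> sections M A \<Longrightarrow> Y \<in> sections M A \<Longrightarrow> nabla X Y \<in> sections M A"
  unfolding dxi_nabla_def
  by (intro sections_sum sections_smult component_smooth D_section)

lemma bracket_section: "X \<in> sections M A \<Longrightarrow> Y \<in> sections M A \<Longrightarrow> bracket X Y \<in> sections M A"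
  unfolding dxi_bracket_def by (intro sections_diff nabla_section)

lemma nabla_add_left:
  assumes "X \<in> sections M A" "Y \<in> sections M A"
  shows "nabla (X + Y) Z = nabla X Z + nabla Y Z"
  using section_in_fibre assms dual_section_linear[OF xi]
  by (simp add: fun_eq_iff nabla_apply linear_on_subspace_def scaleR_add_left sum.distrib)

lemma nabla_smult_left:
  assumes "X \<in> sections M A"
  shows "nabla (h \<odot> X) Z = h \<odot> nabla X Z"
  using section_in_fibre assms dual_section_linear[OF xi]
  by (simp add: fun_eq_iff nabla_apply linear_on_subspace_def scaleR_sum_right)

lemma nabla_add_right:
  assumes "X \<in> sections M A" "Y \<in> sections M A"
  shows "nabla Z (X + Y) = nabla Z X + nabla Z Y"
  using assms differential_operator_add[OF D]
  by (simp add: fun_eq_iff nabla_apply scaleR_add_right sum.distrib)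

lemma nabla_diff_right:
  assumes "X \<in> sections M A" "Y \<in> sections M A"
  shows "nabla Z (X - Y) = nabla Z X - nabla Z Y"
  using assms differential_operator_diff[OF D]
  by (simp add: fun_eq_iff nabla_apply scaleR_diff_right sum_subtractf)

lemma nabla_scaleR_right:
  assumes "X \<in> sections M A"
  shows "nabla Z (c *\<^sub>R X) = c *\<^sub>R nabla Z X"
  using assms differential_operator_scaleR[OF D]
  by (simp add: fun_eq_iff nabla_apply scaleR_sum_right mult.commute)

lemma nabla_smult_right:
  assumes "X \<in> sections M A" "h \<in> Cinf M"
  shows "nabla Z (h \<odot> X) = h \<odot> nabla Z X + vf_apply (on_sections anchor Z) h \<odot> X"
  using assms differential_operator_smult[OF D]
  by (simp add: fun_eq_iff nabla_apply on_sections_apply dxi_anchor_def sum_fun_apply scaleR_add_right sum.distrib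
      scaleR_sum_right scaleR_sum_left mult.commute)

lemma bracket_smult_right:
  assumes "X \<in> sections M A" "Y \<in> sections M A" "h \<in> Cinf M"
  shows "bracket X (h \<odot> Y) = h \<odot> bracket X Y + vf_apply (on_sections anchor X) h \<odot> Y"
  using assms
  by (simp add: dxi_bracket_def nabla_smult_right nabla_smult_left)
     (simp add: fun_eq_iff scaleR_diff_right)

text \<open>The defining equation of the dual operator, solved for the component of \<open>D i X\<close>.\<close>

lemma D_component:
  assumes "i \<in> I" "k \<in> I" "X \<in> sections M A"
  shows "\<xi> k p (D i X p) = D' i p \<langle>X, \<xi> k\<rangle> - (\<Sum>j\<in>I. g i j k p * \<xi> j p (X p))"
proof -
  have "\<langle>X, \<Sum>j\<in>I. g i j k \<odot> \<xi> j\<rangle> = vf_apply (D' i) \<langle>X, \<xi> k\<rangle> - \<langle>D i X, \<xi> k\<rangle>"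
    using dual_operator_pairing[OF D[OF assms(1)] xi[OF assms(2)] assms(3)] dual[OF assms(1,2)]
    by simp
  from fun_cong[OF this, of p] show ?thesis
    by (simp add: sum_fun_apply)
qed

text \<open>By \<open>D_component\<close>, the two halves of the bracket contribute \<open>- g i j k\<close> and, after exchanging the
  indices, \<open>g j i k\<close> to the coefficient of the \<open>i\<close>-th component of \<open>X\<close> times the \<open>j\<close>-th of \<open>Y\<close>.\<close>

lemma bracket_component:
  assumes k: "k \<in> I" and X: "X \<in> sections M A" and Y: "Y \<in> sections M A"
  shows "\<xi> k p (bracket X Y p) =
    (\<Sum>i\<in>I. \<xi> i p (X p) * D' i p \<langle>Y, \<xi> k\<rangle> - \<xi> i p (Y p) * D' i p \<langle>X, \<xi> k\<rangle>) +
    (\<Sum>i\<in>I. \<Sum>j\<in>I. f i j k p * \<xi> i p (X p) * \<xi> j p (Y p))"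
proof -
  define x y where "x i = \<xi> i p (X p)" and "y i = \<xi> i p (Y p)" for i
  have nabla: "\<xi> k p (nabla X Y p) = (\<Sum>i\<in>I. \<xi> i p (X p) * D' i p \<langle>Y, \<xi> k\<rangle>) -
      (\<Sum>i\<in>I. \<Sum>j\<in>I. g i j k p * \<xi> i p (X p) * \<xi> j p (Y p))"
    if X: "X \<in> sections M A" and Y: "Y \<in> sections M A" for X Y
  proof -
    have "\<xi> k p (nabla X Y p) = (\<Sum>i\<in>I. \<xi> i p (X p) *\<^sub>R \<xi> k p (D i Y p))"
      unfolding nabla_apply
      by (rule linear_on_subspace_sum[OF dual_section_linear[OF xi[OF k]] fibre_subspace])
         (use D_section[OF _ Y] section_in_fibre in blast)
    then show ?thesis
      by (simp add: D_component[OF _ k Y] right_diff_distrib sum_subtractf sum_distrib_left mult_ac)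
  qed
  have swap: "(\<Sum>i\<in>I. \<Sum>j\<in>I. g i j k p * y i * x j) = (\<Sum>i\<in>I. \<Sum>j\<in>I. g j i k p * x i * y j)"
    by (subst sum.swap) (simp add: mult_ac)
  have "\<xi> k p (bracket X Y p) = \<xi> k p (nabla X Y p) - \<xi> k p (nabla Y X p)"
    using fun_cong[OF pairing_diff[OF nabla_section[OF X Y] nabla_section[OF Y X] xi[OF k]], of p]
    by (simp add: dxi_bracket_def)
  also have "\<dots> = (\<Sum>i\<in>I. x i * D' i p \<langle>Y, \<xi> k\<rangle> - y i * D' i p \<langle>X, \<xi> k\<rangle>) +
     ((\<Sum>i\<in>I. \<Sum>j\<in>I. g j i k p * x i * y j) - (\<Sum>i\<in>I. \<Sum>j\<in>I. g i j k p * x i * y j))"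
    unfolding nabla[OF X Y] nabla[OF Y X] x_def[symmetric] y_def[symmetric] swap
    by (simp add: sum_subtractf)
  also have "(\<Sum>i\<in>I. \<Sum>j\<in>I. g j i k p * x i * y j) - (\<Sum>i\<in>I. \<Sum>j\<in>I. g i j k p * x i * y j) =
      (\<Sum>i\<in>I. \<Sum>j\<in>I. f i j k p * x i * y j)"
    unfolding sum_subtractf[symmetric]
    by (intro sum.cong refl) (simp add: f_eq k left_diff_distrib)
  finally show ?thesis
    by (simp only: x_def y_def)
qed

text \<open>The first order part of the commutator has the coefficients of \<open>bracket_component\<close>, by
  \<open>double_commutator_sum\<close>.\<close>

lemma nabla_flat:
  assumes X: "X \<in> sections M A" and Y: "Y \<in> sections M A" and Z: "Z \<in> sections M A"
  shows "nabla X (nabla Y Z) - nabla Y (nabla X Z) = nabla (bracket X Y) Z"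
proof
  fix p
  have second: "nabla X (nabla Y Z) p = (\<Sum>i\<in>I. \<xi> i p (X p) *\<^sub>R
      (\<Sum>j\<in>I. \<xi> j p (Y p) *\<^sub>R D i (D j Z) p + D' i p \<langle>Y, \<xi> j\<rangle> *\<^sub>R D j Z p))"
    if X: "X \<in> sections M A" and Y: "Y \<in> sections M A" for X Y
  proof -
    have "D i (nabla Y Z) p = (\<Sum>j\<in>I. \<xi> j p (Y p) *\<^sub>R D i (D j Z) p + D' i p \<langle>Y, \<xi> j\<rangle> *\<^sub>R D j Z p)"
      if i: "i \<in> I" for i
    proof -
      have "D i (nabla Y Z) = (\<Sum>j\<in>I. D i (\<langle>Y, \<xi> j\<rangle> \<odot> D j Z))"
        unfolding dxi_nabla_def
        by (rule differential_operator_sum[OF D[OF i]])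
           (intro sections_smult component_smooth D_section Y Z)
      also have "\<dots> = (\<Sum>j\<in>I. \<langle>Y, \<xi> j\<rangle> \<odot> D i (D j Z) + vf_apply (D' i) \<langle>Y, \<xi> j\<rangle> \<odot> D j Z)"
        by (intro sum.cong refl differential_operator_smult[OF D[OF i]] D_section Z component_smooth Y)
      finally show ?thesis by (simp add: sum_fun_apply)
    qed
    then show ?thesis by (simp add: nabla_apply)
  qed
  have comm: "D i (D j Z) p - D j (D i Z) p = (\<Sum>k\<in>I. f i j k p *\<^sub>R D k Z p)" if "i \<in> I" "j \<in> I" for i j
    using fun_cong[OF D_comm[OF that Z], of p] by (simp add: sum_fun_apply)
  have "nabla X (nabla Y Z) p - nabla Y (nabla X Z) p = nabla (bracket X Y) Z p"
    unfolding second[OF X Y] second[OF Y X] nabla_apply[of "bracket X Y"]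
    by (subst double_commutator_sum[OF I comm])
       (auto intro!: sum.cong simp: bracket_component[OF _ X Y])
  then show "(nabla X (nabla Y Z) - nabla Y (nabla X Z)) p = nabla (bracket X Y) Z p"
    by simp
qed

text \<open>Flatness turns \<open>nabla (bracket Y Z) X\<close> into second covariant derivatives of \<open>X\<close>; in the cyclic sum
  each of the six second covariant derivatives then occurs twice, with opposite signs.\<close>

lemma bracket_jacobi:
  assumes X: "X \<in> sections M A" and Y: "Y \<in> sections M A" and Z: "Z \<in> sections M A"
  shows "bracket X (bracket Y Z) + bracket Y (bracket Z X) + bracket Z (bracket X Y) = 0"
proof -
  have "bracket X (bracket Y Z) = nabla X (nabla Y Z) - nabla X (nabla Z Y) -
      (nabla Y (nabla Z X) - nabla Z (nabla Y X))"
    if X: "X \<in> sections M A" and Y: "Y \<in> sections M A" and Z: "Z \<in> sections M A" for X Y Z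
  proof -
    have "bracket X (bracket Y Z) = nabla X (bracket Y Z) - nabla (bracket Y Z) X"
      by (simp only: dxi_bracket_def)
    also have "nabla X (bracket Y Z) = nabla X (nabla Y Z) - nabla X (nabla Z Y)"
      unfolding dxi_bracket_def by (intro nabla_diff_right nabla_section Y Z)
    finally show ?thesis
      unfolding nabla_flat[OF Y Z X, symmetric] .
  qed
  from this[OF X Y Z] this[OF Y Z X] this[OF Z X Y] show ?thesis
    by simp
qed

lemma lie_bracket_on_sections: "lie_bracket_on (sections M A) bracket"
proof -
  have scaleR_left: "nabla (c *\<^sub>R X) Z = c *\<^sub>R nabla X Z" if "X \<in> sections M A" for c X Z
    unfolding scaleR_eq_const_smult by (rule nabla_smult_left[OF that])
  show ?thesis
    unfolding lie_bracket_on_def linear_on_subspace_def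
    using bracket_section bracket_jacobi
    by (auto simp: dxi_bracket_def nabla_add_left nabla_add_right nabla_scaleR_right scaleR_left
        scaleR_diff_right algebra_simps)
qed

text \<open>Expand the commutator relation on \<open>F \<odot> Y\<close>: the terms with one derivative on \<open>F\<close> and one on \<open>Y\<close> are symmetric
  in \<open>i\<close> and \<open>j\<close>, those with both derivatives on \<open>Y\<close> satisfy the relation for \<open>Y\<close>, and what is left is a multiple
  of \<open>Y p\<close>. Positive rank provides a \<open>Y\<close> with \<open>Y p \<noteq> 0\<close>.\<close>

lemma symbol_commutator:
  assumes r: "0 < rank A" and F: "F \<in> Cinf M" and ij: "i \<in> I" "j \<in> I"
  shows "D' i p (vf_apply (D' j) F) - D' j p (vf_apply (D' i) F) = (\<Sum>k\<in>I. f i j k p * D' k p F)"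
proof -
  obtain U \<Phi> where U: "(U, \<Phi>) \<in> trivs A" "p \<in> U" by (rule ex_triv)
  have "local_frame A \<Phi> 0 p \<noteq> 0"
    using triv_local_frame[OF U r] linear_on_subspace_0[OF triv_linear[OF U] fibre_subspace]
    by (metis one_neq_zero unit_vec_def zero_fun_apply)
  moreover obtain Y where Y: "Y \<in> sections M A" "Y p = local_frame A \<Phi> 0 p"
    using ex_section_through[OF local_frame_in_fibre[OF U r]] by blast
  ultimately have Yp: "Y p \<noteq> 0" by simp
  have second: "D i (D j (F \<odot> Y)) p = F p *\<^sub>R D i (D j Y) p + D' i p F *\<^sub>R D j Y p +
      D' j p F *\<^sub>R D i Y p + D' i p (vf_apply (D' j) F) *\<^sub>R Y p"
    if i: "i \<in> I" and j: "j \<in> I" for i j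
  proof -
    have G: "vf_apply (D' j) F \<in> Cinf M" by (rule symbol_smooth[OF D[OF j] r F])
    have "D i (D j (F \<odot> Y)) = D i (F \<odot> D j Y) + D i (vf_apply (D' j) F \<odot> Y)"
      unfolding differential_operator_smult[OF D[OF j] Y(1) F]
      by (intro differential_operator_add[OF D[OF i]] sections_smult D_section Y F G j)
    then show ?thesis
      using differential_operator_smult[OF D[OF i] D_section[OF j Y(1)] F]
        differential_operator_smult[OF D[OF i] Y(1) G] by simp
  qed
  have comm: "D i (D j Z) p - D j (D i Z) p = (\<Sum>k\<in>I. f i j k p *\<^sub>R D k Z p)" if "Z \<in> sections M A" for Z
    using fun_cong[OF D_comm[OF ij that], of p] by (simp add: sum_fun_apply)
  have "F p *\<^sub>R (D i (D j Y) p - D j (D i Y) p) +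
      (D' i p (vf_apply (D' j) F) - D' j p (vf_apply (D' i) F)) *\<^sub>R Y p =
      D i (D j (F \<odot> Y)) p - D j (D i (F \<odot> Y)) p"
    unfolding second[OF ij] second[OF ij(2,1)] by (simp add: algebra_simps)
  also have "\<dots> = (\<Sum>k\<in>I. f i j k p *\<^sub>R (F p *\<^sub>R D k Y p + D' k p F *\<^sub>R Y p))"
    unfolding comm[OF sections_smult[OF F Y(1)]]
    by (intro sum.cong refl) (simp add: differential_operator_smult[OF D Y(1) F])
  also have "\<dots> = F p *\<^sub>R (\<Sum>k\<in>I. f i j k p *\<^sub>R D k Y p) + (\<Sum>k\<in>I. f i j k p * D' k p F) *\<^sub>R Y p"
    by (simp add: scaleR_add_right sum.distrib scaleR_sum_right scaleR_sum_left mult.commute)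
  finally show ?thesis
    using Yp unfolding comm[OF Y(1)] by simp
qed

lemma anchor_apply: "on_sections anchor X p h = (\<Sum>i\<in>I. \<xi> i p (X p) * D' i p h)"
  by (simp add: on_sections_apply dxi_anchor_def sum_fun_apply)

text \<open>On a globally smooth function this is \<open>double_commutator_sum\<close> for the symbols. A function that is only smooth
  near \<open>p\<close> is replaced by a global one with the same germ, which tangent vectors do not distinguish.\<close>

lemma anchor_bracket:
  assumes X: "X \<in> sections M A" and Y: "Y \<in> sections M A"
  shows "on_sections anchor (bracket X Y) = vf_bracket M (on_sections anchor X) (on_sections anchor Y)"
proof (intro ext)
  fix p h
  show "on_sections anchor (bracket X Y) p h = vf_bracket M (on_sections anchor X) (on_sections anchor Y) p h"
  proof (cases "smooth_near M p h \<and> 0 < rank A")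
    case False
    then consider "\<not> smooth_near M p h" | "rank A = 0" by auto
    then show ?thesis
    proof cases
      case 1
      then have "D' i p h = 0" if "i \<in> I" for i
        using vector_field_tangent[OF D'_vector_field[OF that], of p] by (simp add: tangent_space_def)
      then show ?thesis
        using 1 by (simp add: anchor_apply vf_bracket_def)
    next
      \<comment> \<open>In rank \<open>0\<close> the symbols need not satisfy any commutation relation, but the anchor is zero.\<close>
      case 2
      have "\<xi> i p (Z p) = 0" if "i \<in> I" "Z \<in> sections M A" for i Z
        using fun_cong[OF pairing_rank_0[OF 2 that(2) xi[OF that(1)]], of p] by simp
      then show ?thesis
        using X Y bracket_section[OF X Y] by (simp add: anchor_apply vf_bracket_def)
    qed
  next
    case True
    then have r: "0 < rank A" and h: "smooth_near M p h" by auto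
    obtain F N where F: "F \<in> Cinf M" "open N" "p \<in> N" "\<And>q. q \<in> N \<Longrightarrow> F q = h q"
      using smooth_near_extend[OF h] by blast
    have germ: "D' i q h = D' i q F" if "i \<in> I" "q \<in> N" for i q
      using tangent_vector_germ[OF vector_field_tangent[OF D'_vector_field[OF that(1)]] F(2) that(2)]
        F(4) by metis
    have second: "on_sections anchor X p (vf_apply (on_sections anchor Y) h) = (\<Sum>i\<in>I. \<xi> i p (X p) *\<^sub>R
        (\<Sum>j\<in>I. \<xi> j p (Y p) *\<^sub>R D' i p (vf_apply (D' j) F) + D' i p \<langle>Y, \<xi> j\<rangle> *\<^sub>R D' j p F))"
      if X: "X \<in> sections M A" and Y: "Y \<in> sections M A" for X Y
    proof -
      have G: "vf_apply (D' j) F \<in> Cinf M" if "j \<in> I" for j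
        by (rule symbol_smooth[OF D[OF that] r F(1)])
      have "D' i p (vf_apply (on_sections anchor Y) h) =
          (\<Sum>j\<in>I. \<xi> j p (Y p) *\<^sub>R D' i p (vf_apply (D' j) F) + D' i p \<langle>Y, \<xi> j\<rangle> *\<^sub>R D' j p F)"
        if i: "i \<in> I" for i
      proof -
        note V = D'_vector_field[OF i]
        have global: "D' i p (vf_apply (on_sections anchor Y) h) = D' i p (\<Sum>j\<in>I. \<langle>Y, \<xi> j\<rangle> * vf_apply (D' j) F)"
          by (rule tangent_vector_germ[OF vector_field_tangent[OF V] F(2,3)])
             (simp add: anchor_apply sum_fun_apply germ)
        have "vf_apply (D' i) (\<Sum>j\<in>I. \<langle>Y, \<xi> j\<rangle> * vf_apply (D' j) F) =
            (\<Sum>j\<in>I. vf_apply (D' i) (\<langle>Y, \<xi> j\<rangle> * vf_apply (D' j) F))"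
          by (intro vf_apply_sum[OF V] Cinf_mult component_smooth Y G)
        also have "\<dots> = (\<Sum>j\<in>I. \<langle>Y, \<xi> j\<rangle> * vf_apply (D' i) (vf_apply (D' j) F) +
            vf_apply (D' j) F * vf_apply (D' i) \<langle>Y, \<xi> j\<rangle>)"
          by (intro sum.cong refl vf_apply_mult[OF V] component_smooth Y G)
        finally have "vf_apply (D' i) (\<Sum>j\<in>I. \<langle>Y, \<xi> j\<rangle> * vf_apply (D' j) F) p =
            (\<Sum>j\<in>I. \<langle>Y, \<xi> j\<rangle> p * vf_apply (D' i) (vf_apply (D' j) F) p +
              vf_apply (D' j) F p * vf_apply (D' i) \<langle>Y, \<xi> j\<rangle> p)"
          by (simp only: sum_fun_apply plus_fun_apply times_fun_apply)
        then show ?thesis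
          unfolding global by (simp only: vf_apply_apply pairing_apply real_scaleR_def mult.commute)
      qed
      then show ?thesis by (simp add: anchor_apply)
    qed
    have comm: "D' i p (vf_apply (D' j) F) - D' j p (vf_apply (D' i) F) = (\<Sum>k\<in>I. f i j k p *\<^sub>R D' k p F)"
      if "i \<in> I" "j \<in> I" for i j
      using symbol_commutator[OF r F(1) that] by simp
    have "vf_bracket M (on_sections anchor X) (on_sections anchor Y) p h =
        (\<Sum>k\<in>I. \<xi> k p (bracket X Y p) *\<^sub>R D' k p F)"
      using h unfolding vf_bracket_def second[OF X Y] second[OF Y X]
      by (subst double_commutator_sum[OF I comm])
         (auto intro!: sum.cong simp: bracket_component[OF _ X Y])
    then show ?thesis
      using germ[OF _ F(3)] by (simp add: anchor_apply)
  qed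
qed

lemma anchor_morphism: "vb_morphism M A (tangent_bundle M) anchor"
  unfolding vb_morphism_def
proof (intro conjI allI ballI, goal_cases)
  case (1 p)
  have "anchor p x \<in> tangent_space M p" for x
    unfolding dxi_anchor_def
    by (intro subspace_sum subspace_scale subspace_tangent_space vector_field_tangent D'_vector_field)
  then show ?case by (auto simp: tangent_bundle_def)
next
  case (2 p)
  then show ?case
    using dual_section_linear[OF xi]
    by (simp add: linear_on_subspace_def dxi_anchor_def scaleR_add_left sum.distrib scaleR_sum_right)
next
  case (3 a)
  obtain U \<Phi> where a: "a = (U, \<Phi>)" "(U, \<Phi>) \<in> trivs A" using 3 by (cases a) auto
  have "smooth_fun_on M (U \<inter> V) (\<lambda>p. anchor p (local_frame A \<Phi> j p) (\<lambda>q. \<phi> q i))"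
    if V: "(V, \<phi>) \<in> atlas M" and j: "j < rank A" and i: "i < mdim M" for V \<phi> i j
  proof -
    have o: "open U" "open V" "open (U \<inter> V)"
      using triv_open[OF a(2)] chart_open[OF V] by auto
    have "smooth_fun_on M (U \<inter> V) (\<lambda>p. \<xi> k p (local_frame A \<Phi> j p))" if "k \<in> I" for k
      using dual_section_component_smooth[OF xi[OF that] a(2) j]
      by (rule smooth_fun_on_subset[OF o(1,3) Int_lower1])
    moreover have "smooth_fun_on M (U \<inter> V) (\<lambda>p. D' k p (\<lambda>q. \<phi> q i))" if "k \<in> I" for k
    proof -
      have "smooth_fun_on M V (\<lambda>p. D' k p (\<lambda>q. \<phi> q i))"
        using D'_vector_field[OF that] V i by (fastforce simp: sections_def tangent_bundle_def)
      then show ?thesis by (rule smooth_fun_on_subset[OF o(2,3) Int_lower2])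
    qed
    ultimately have "smooth_fun_on M (U \<inter> V)
        (\<lambda>p. \<Sum>k\<in>I. \<xi> k p (local_frame A \<Phi> j p) * D' k p (\<lambda>q. \<phi> q i))"
      by (intro smooth_fun_on_sum[OF o(3)] smooth_fun_on_mult[OF o(3)])
    then show ?thesis
      by (simp add: dxi_anchor_def sum_fun_apply)
  qed
  then show ?case
    by (auto simp: a tangent_bundle_def)
qed

lemma lie_algebroid: "lie_algebroid M A anchor bracket"
  unfolding lie_algebroid_def anchored_bundle_def
  using is_manifold is_vector_bundle anchor_morphism lie_bracket_on_sections anchor_bracket bracket_smult_right by blast

end

theorem proposition3p2:
  fixes M :: "'m::{t2_space,second_countable_topology} mfd"
    and A :: "('m, 'v::real_vector) vbundle"
    and \<rho> :: "'m \<Rightarrow> 'v \<Rightarrow> ('m \<Rightarrow> real) \<Rightarrow> real"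
    and I :: "'i set"
    and D :: "'i \<Rightarrow> ('m \<Rightarrow> 'v) \<Rightarrow> 'm \<Rightarrow> 'v"
    and D' :: "'i \<Rightarrow> 'm \<Rightarrow> ('m \<Rightarrow> real) \<Rightarrow> real"
    and \<xi> :: "'i \<Rightarrow> 'm \<Rightarrow> 'v \<Rightarrow> real"
    and f g :: "'i \<Rightarrow> 'i \<Rightarrow> 'i \<Rightarrow> 'm \<Rightarrow> real"
  assumes "anchored_bundle M A \<rho>"
    and "finite I"
    and "\<And>i. i \<in> I \<Longrightarrow> differential_operator M A (D i) (D' i)"
    and "\<And>i j k. i \<in> I \<Longrightarrow> j \<in> I \<Longrightarrow> k \<in> I \<Longrightarrow> f i j k \<in> Cinf M"
    and "\<And>i j Y. i \<in> I \<Longrightarrow> j \<in> I \<Longrightarrow> Y \<in> sections M A \<Longrightarrow>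
           D i (D j Y) - D j (D i Y) = (\<Sum>k\<in>I. f i j k \<odot> D k Y)"
    and "\<And>i. i \<in> I \<Longrightarrow> \<xi> i \<in> sections M (dual_bundle A)"
    and "\<And>i j k. i \<in> I \<Longrightarrow> j \<in> I \<Longrightarrow> k \<in> I \<Longrightarrow> g i k j \<in> Cinf M"
    and "\<And>i j. i \<in> I \<Longrightarrow> j \<in> I \<Longrightarrow>
           dual_operator M A (D i) (D' i) (\<xi> j) = (\<Sum>k\<in>I. g i k j \<odot> \<xi> k)"
    and "\<And>i j k. i \<in> I \<Longrightarrow> j \<in> I \<Longrightarrow> k \<in> I \<Longrightarrow> f i j k = g j i k - g i j k"
  shows "lie_algebroid M A (dxi_anchor I D' \<xi>) (dxi_bracket I D \<xi>)"
proof -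
  interpret operator_family M A I D D' \<xi> f g
    using assms by unfold_locales (auto simp: anchored_bundle_def)
  show ?thesis by (rule lie_algebroid)
qed

end
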